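(* Let $F$ be any field containing all roots of unity. Then the absolute Galois group $G_F=\mathrm{Gal}(F^{\mathrm{sep}}/F)$ of $F$ is totally torsion free.
   Context: A Hausdorff topological group $G$ is called totally torsion free if the abelianization of every closed subgroup of $G$ is torsion free. Here the abelianization of a closed subgroup $K$ means the quotient of $K$ by the closure of its commutator subgroup. $F^{\mathrm{sep}}$ denotes a separable closure of $F$, and $G_F$ carries its usual profinite topology. "Containing all roots of unity" means that $F$ contains all roots of unity of an algebraic closure of $F$ (in characteristic $p>0$ these are the roots of unity of order prime to $p$). *)

theory Defs
  imports "HOL-Analysis.Analysis" "HOL-Algebra.Algebra" "HOL-Algebra.Algebraic_Closure_Type"
begin

section \<open>Totally torsion free topological groups\<close>

locale hausdorff_topological_group = group G
  for G :: "('a, 'b) monoid_scheme" (structure) and T :: "'a topology" +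
  assumes topspace_eq_carrier: "topspace T = carrier G"
    and continuous_mult: "continuous_map (prod_topology T T) T (\<lambda>(x, y). x \<otimes> y)"
    and continuous_inv: "continuous_map T T (\<lambda>x. inv x)"
    and Hausdorff: "Hausdorff_space T"

definition topological_abelianization ::
  "('a, 'b) monoid_scheme \<Rightarrow> 'a topology \<Rightarrow> 'a set monoid" where
  "topological_abelianization G T = G Mod (T closure_of (derived G (carrier G)))"

definition torsion_free :: "('a, 'b) monoid_scheme \<Rightarrow> bool" where
  "torsion_free G \<longleftrightarrow>
     (\<forall>x \<in> carrier G. \<forall>n::nat. n > 0 \<longrightarrow> x [^]\<^bsub>G\<^esub> n = \<one>\<^bsub>G\<^esub> \<longrightarrow> x = \<one>\<^bsub>G\<^esub>)"

definition totally_torsion_free ::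
  "('a, 'b) monoid_scheme \<Rightarrow> 'a topology \<Rightarrow> bool" where
  "totally_torsion_free G T \<longleftrightarrow>
     hausdorff_topological_group G T \<and>
     (\<forall>K. subgroup K G \<and> closedin T K \<longrightarrow>
        torsion_free (topological_abelianization (G\<lparr>carrier := K\<rparr>) (subtopology T K)))"

section \<open>Separable closures\<close>

definition field_embedding :: "('f::field \<Rightarrow> 'k::field) \<Rightarrow> bool" where
  "field_embedding i \<longleftrightarrow>
     i 1 = 1 \<and> (\<forall>x y. i (x + y) = i x + i y) \<and> (\<forall>x y. i (x * y) = i x * i y)"

definition separable_poly :: "'f::field poly \<Rightarrow> bool" where
  "separable_poly p \<longleftrightarrow> coprime p (pderiv p)"

text \<open>The irreducible polynomial below is, up to a unit, the minimal polynomial of \<open>x\<close>;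
  in particular \<open>x\<close> is algebraic.\<close>
definition separable_over :: "('f::field \<Rightarrow> 'k::field) \<Rightarrow> 'k \<Rightarrow> bool" where
  "separable_over i x \<longleftrightarrow>
     (\<exists>p. Factorial_Ring.irreducible p \<and> separable_poly p \<and> poly (map_poly i p) x = 0)"

definition separably_closed :: "'k::field itself \<Rightarrow> bool" where
  "separably_closed _ \<longleftrightarrow>
     (\<forall>p::'k poly. separable_poly p \<and> Polynomial.degree p > 0 \<longrightarrow> (\<exists>x. poly p x = 0))"

definition separable_closure :: "('f::field \<Rightarrow> 'k::field) \<Rightarrow> bool" where
  "separable_closure i \<longleftrightarrow>
     field_embedding i \<and> (\<forall>x. separable_over i x) \<and> separably_closed TYPE('k)"

section \<open>Galois groups and the Krull topology\<close>

definition Gal :: "('f::field \<Rightarrow> 'k::field) \<Rightarrow> ('k \<Rightarrow> 'k) monoid" where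
  "Gal i = \<lparr>carrier = {\<sigma>. field_embedding \<sigma> \<and> bij \<sigma> \<and> (\<forall>a. \<sigma> (i a) = i a)},
            mult = (\<circ>), one = id\<rparr>"

definition intermediate_field :: "('f::field \<Rightarrow> 'k::field) \<Rightarrow> 'k set \<Rightarrow> bool" where
  "intermediate_field i E \<longleftrightarrow>
     range i \<subseteq> E \<and>
     (\<forall>x\<in>E. \<forall>y\<in>E. x + y \<in> E \<and> x * y \<in> E) \<and> (\<forall>x\<in>E. - x \<in> E \<and> inverse x \<in> E)"

definition finite_subextension :: "('f::field \<Rightarrow> 'k::field) \<Rightarrow> 'k set \<Rightarrow> bool" where
  "finite_subextension i E \<longleftrightarrow>
     intermediate_field i E \<and>
     (\<exists>B. finite B \<and> B \<subseteq> E \<and> (\<forall>x\<in>E. \<exists>c. x = (\<Sum>b\<in>B. i (c b) * b)))"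

definition fixing_subgroup :: "('f::field \<Rightarrow> 'k::field) \<Rightarrow> 'k set \<Rightarrow> ('k \<Rightarrow> 'k) set" where
  "fixing_subgroup i E = {\<sigma> \<in> carrier (Gal i). \<forall>x\<in>E. \<sigma> x = x}"

text \<open>The profinite topology on the Galois group: the cosets of the subgroups fixing a finite
  subextension are a basis. (The coset for \<open>E = range i\<close> is the whole group.)\<close>
definition krull_topology :: "('f::field \<Rightarrow> 'k::field) \<Rightarrow> ('k \<Rightarrow> 'k) topology" where
  "krull_topology i = topology_generated_by
     {\<sigma> <#\<^bsub>Gal i\<^esub> fixing_subgroup i E | \<sigma> E. \<sigma> \<in> carrier (Gal i) \<and> finite_subextension i E}"

section \<open>Roots of unity\<close>

text \<open>Roots of unity whose order is divisible by the characteristic need no separate treatment: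
  \<open>x ^ (p * n) = 1\<close> already gives \<open>x ^ n = 1\<close> in characteristic \<open>p\<close>.\<close>
definition contains_all_roots_of_unity :: "'f::field itself \<Rightarrow> bool" where
  "contains_all_roots_of_unity _ \<longleftrightarrow>
     (\<forall>(x :: 'f alg_closure) (n::nat). n > 0 \<and> x ^ n = 1 \<longrightarrow> x \<in> range to_ac)"

end

theory Submission
  imports Defs
begin

text \<open>
  Let \<open>K\<close> be a closed subgroup of the Galois group, \<open>L\<close> its fixed field, and \<open>N\<close> the closure of
  the commutator subgroup of \<open>K\<close>. By Galois theory \<open>N\<close> consists of the elements of \<open>K\<close> that act
  trivially on \<open>M\<close>, the maximal abelian extension of \<open>L\<close>. Hence \<open>K/N\<close> is torsion free if, for
  every prime \<open>l\<close>, an element \<open>c\<close> of \<open>K\<close> whose \<open>l\<close>-th power is trivial on \<open>M\<close> is itself trivial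
  on \<open>M\<close>. In dual terms: every continuous character of \<open>K\<close> of \<open>l\<close>-power order is divisible by
  \<open>l\<close>.

  If \<open>l\<close> is not the characteristic, this is Kummer theory. Such a character is the action of \<open>K\<close>
  on some \<open>w\<close> in \<open>M\<close> that \<open>K\<close> multiplies by roots of unity, and the action on an \<open>l\<close>-th root of
  \<open>w\<close> divides it by \<open>l\<close>. That action is again a character because all roots of unity lie in \<open>F\<close>
  (\<open>trivial_on_M_prime_to_char\<close>). The element \<open>w\<close> is found as a joint eigenvector of \<open>K\<close>
  (\<open>joint_eigenvector\<close>).

  If \<open>l = p\<close> is the characteristic, a cyclic extension of degree \<open>p^m\<close> of \<open>L\<close> embeds into one of
  degree \<open>p^(m+1)\<close> by Artin-Schreier theory (\<open>trivial_on_M_char\<close>). That such an extension exists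
  in which \<open>c\<close> is nontrivial is a statement about abelian groups
  (\<open>cyclic_quotient_detecting_prime_order\<close>).

  The description of \<open>N\<close> by its fixed field rests on \<open>fixed_element_moved_if_no_agreement\<close>, and
  on the fact that the Krull topology is that of pointwise convergence
  (\<open>openin_krull_topology\<close>).
\<close>

section \<open>Ring homomorphisms and finite orbits\<close>

text \<open>The notion covers embeddings of fields as well as the maps between polynomial rings that
  they induce on coefficients.\<close>
definition ring_map :: "('a::comm_ring_1 \<Rightarrow> 'b::comm_ring_1) \<Rightarrow> bool" where
  "ring_map f \<longleftrightarrow> f 1 = 1 \<and> (\<forall>x y. f (x + y) = f x + f y) \<and> (\<forall>x y. f (x * y) = f x * f y)"

lemma field_embedding_ring_map: "field_embedding f \<longleftrightarrow> ring_map f"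
  by (simp add: field_embedding_def ring_map_def)

lemma ring_map_1: "ring_map f \<Longrightarrow> f 1 = 1"
  and ring_map_add: "ring_map f \<Longrightarrow> f (x + y) = f x + f y"
  and ring_map_mult: "ring_map f \<Longrightarrow> f (x * y) = f x * f y"
  by (simp_all add: ring_map_def)

lemma ring_map_0: "ring_map f \<Longrightarrow> f 0 = 0"
  using ring_map_add[of f 0 0] by simp

lemma ring_map_uminus: "ring_map f \<Longrightarrow> f (- x) = - f x"
  using ring_map_add[of f "-x" x] ring_map_0[of f] by (simp add: eq_neg_iff_add_eq_0)

lemma ring_map_diff: "ring_map f \<Longrightarrow> f (x - y) = f x - f y"
  using ring_map_add[of f x "-y"] ring_map_uminus[of f y] by simp

lemma ring_map_sum: "ring_map f \<Longrightarrow> f (sum g A) = (\<Sum>x\<in>A. f (g x))"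
  by (induction A rule: infinite_finite_induct) (auto simp: ring_map_0 ring_map_add)

lemma ring_map_prod: "ring_map f \<Longrightarrow> f (prod g A) = (\<Prod>x\<in>A. f (g x))"
  by (induction A rule: infinite_finite_induct) (auto simp: ring_map_1 ring_map_mult)

lemma ring_map_power: "ring_map f \<Longrightarrow> f (x ^ n) = f x ^ n"
  by (induction n) (auto simp: ring_map_1 ring_map_mult)

lemma ring_map_of_nat: "ring_map f \<Longrightarrow> f (of_nat n) = of_nat n"
  by (induction n) (auto simp: ring_map_0 ring_map_1 ring_map_add)

lemmas ring_map_simps = ring_map_0 ring_map_1 ring_map_add ring_map_mult ring_map_uminus
  ring_map_diff ring_map_power ring_map_of_nat

lemma ring_map_inj:
  fixes f :: "'a::field \<Rightarrow> 'b::field"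
  assumes "ring_map f" shows "inj f"
proof (rule injI)
  fix x y assume "f x = f y"
  then have "f (x - y) = 0" using assms by (simp add: ring_map_diff)
  then have "f (x - y) * f (inverse (x - y)) = 0" by simp
  then have "f ((x - y) * inverse (x - y)) = 0" using assms by (simp add: ring_map_mult)
  then have "(x - y) * inverse (x - y) \<noteq> 1" using assms by (auto simp: ring_map_1)
  then show "x = y" by (cases "x = y") auto
qed

lemma ring_map_inverse:
  fixes f :: "'a::field \<Rightarrow> 'b::field"
  assumes "ring_map f" shows "f (inverse x) = inverse (f x)"
proof (cases "x = 0")
  case False
  then have "f x * f (inverse x) = 1" using assms by (simp add: ring_map_1 flip: ring_map_mult)
  then show ?thesis by (metis inverse_unique)
qed (use assms in \<open>simp add: ring_map_0\<close>)

lemma ring_map_map_poly: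
  assumes f: "ring_map f" shows "ring_map (map_poly f)"
proof -
  have cf: "Polynomial.coeff (map_poly f p) n = f (Polynomial.coeff p n)" for p n
    by (rule coeff_map_poly) (use f in \<open>simp add: ring_map_0\<close>)
  show ?thesis
    unfolding ring_map_def
    using f
    by (auto simp: poly_eq_iff cf coeff_mult ring_map_sum ring_map_simps map_poly_1')
qed

lemma poly_map_poly:
  assumes f: "ring_map f" shows "poly (map_poly f p) (f x) = f (poly p x)"
  by (induction p) (use f in \<open>simp_all add: map_poly_pCons ring_map_simps\<close>)

lemma coeff_map_poly_ring_map:
  "ring_map f \<Longrightarrow> Polynomial.coeff (map_poly f p) n = f (Polynomial.coeff p n)"
  by (rule coeff_map_poly) (simp add: ring_map_0)

text \<open>The coefficients of \<open>\<Prod>w\<in>S. (X - w)\<close> are fixed by \<open>D\<close>, since \<open>D\<close> only permutes the factors.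
  Hence they are fixed by \<open>s\<close>, and \<open>s\<close> maps roots of this polynomial to roots. This is the part
  of Artin's theorem that is needed; it is stated for integral domains because it is applied to
  a polynomial ring as well as to a field.\<close>
lemma image_in_finite_orbit:
  fixes S :: "'r::idom set"
  assumes S: "finite S" "u \<in> S"
    and D: "\<And>r. r \<in> D \<Longrightarrow> ring_map r \<and> inj_on r S \<and> r ` S = S"
    and s: "ring_map s" "\<And>y. (\<And>r. r \<in> D \<Longrightarrow> r y = y) \<Longrightarrow> s y = y"
  shows "s u \<in> S"
proof -
  define P where "P = (\<Prod>w\<in>S. [:- w, 1:])"
  have "map_poly r P = P" if "r \<in> D" for r
  proof -
    have r: "ring_map r" "inj_on r S" "r ` S = S" using D that by auto
    have "map_poly r P = (\<Prod>w\<in>S. [:- r w, 1:])"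
      unfolding P_def ring_map_prod[OF ring_map_map_poly[OF r(1)]]
      by (simp add: map_poly_pCons ring_map_simps r(1))
    also have "\<dots> = (\<Prod>w\<in>r ` S. [:- w, 1:])"
      using r(2) by (simp add: prod.reindex)
    finally show ?thesis by (simp add: P_def r(3))
  qed
  then have "r (Polynomial.coeff P n) = Polynomial.coeff P n" if "r \<in> D" for r n
    using coeff_map_poly_ring_map D that by metis
  then have "s (Polynomial.coeff P n) = Polynomial.coeff P n" for n
    using s(2) by blast
  then have "map_poly s P = P"
    by (simp add: poly_eq_iff coeff_map_poly_ring_map s(1))
  then have "poly P (s u) = s (poly P u)"
    using poly_map_poly[OF s(1)] by metis
  also have "poly P u = 0"
    using S by (auto simp: P_def poly_prod)
  finally have "poly P (s u) = 0" using s(1) by (simp add: ring_map_0)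
  then show ?thesis
    using S(1) by (auto simp: P_def poly_prod)
qed

section \<open>Cyclic quotients of abelian groups\<close>

lemma only_prime_divisor_imp_power:
  fixes p n :: nat
  assumes "Factorial_Ring.prime p" "n > 0" "\<And>q. Factorial_Ring.prime q \<Longrightarrow> q dvd n \<Longrightarrow> q = p"
  shows "\<exists>a. n = p ^ a"
  using assms(2,3)
proof (induction n rule: less_induct)
  case (less n)
  show ?case
  proof (cases "n = 1")
    case True
    then show ?thesis by (intro exI[of _ 0]) simp
  next
    case False
    then obtain q where "Factorial_Ring.prime q" "q dvd n" using prime_factor_nat by blast
    then have "p dvd n" using less.prems by blast
    then obtain k where k: "n = p * k" by blast
    have "k < n" "k > 0" using k less.prems(1) prime_gt_1_nat[OF assms(1)] by auto
    moreover have "q = p" if "Factorial_Ring.prime q" "q dvd k" for q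
      using less.prems(2)[of q] that k by simp
    ultimately obtain a where "k = p ^ a" using less.IH by blast
    then show ?thesis using k by (intro exI[of _ "Suc a"]) simp
  qed
qed

text \<open>If every nontrivial cyclic subgroup of an abelian group of finite exponent contains the
  same element \<open>c\<close> of order \<open>p\<close>, the group is a cyclic \<open>p\<close>-group. An element \<open>s\<close> of largest
  order generates: outside the subgroup of \<open>s\<close> there would be some \<open>u\<close> whose \<open>p\<close>-th power \<open>s^j\<close>
  lies in it. As the order of \<open>u\<close> divides that of \<open>s\<close>, the exponent \<open>j\<close> is divisible by \<open>p\<close>, and
  dividing \<open>u\<close> by \<open>s^(j/p)\<close> gives an element \<open>v\<close> of order \<open>p\<close> outside the subgroup of \<open>s\<close>. But
  \<open>v\<close> generates the same subgroup as \<open>c\<close>, which is a power of \<open>s\<close>.\<close>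
lemma (in comm_group) cyclic_if_socle_simple:
  fixes n p :: nat
  assumes n: "n > 0" "\<And>t. t \<in> carrier G \<Longrightarrow> t [^] n = \<one>"
    and p: "Factorial_Ring.prime p" and c: "c \<in> carrier G" "c \<noteq> \<one>" "c [^] p = \<one>"
    and soc: "\<And>t. t \<in> carrier G \<Longrightarrow> t \<noteq> \<one> \<Longrightarrow> \<exists>j::nat. t [^] j = c"
  shows "\<exists>s\<in>carrier G. \<exists>m>0. ord s = p ^ m \<and> (\<forall>t\<in>carrier G. \<exists>j::nat. t = s [^] j)"
proof -
  have ordc: "ord c = p"
  proof -
    have "ord c dvd p" using c pow_eq_id by blast
    moreover have "ord c \<noteq> 1" using c ord_eq_1 by blast
    ultimately show ?thesis using p by (metis prime_nat_iff)
  qed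
  have ord_pos: "ord t > 0" and ord_le: "ord t \<le> n" if "t \<in> carrier G" for t
    using n(2)[OF that] pow_eq_id[OF that] n(1) by (auto intro: dvd_imp_le dest: dvd_pos_nat)
  have ord_pow_p: "\<exists>a. ord t = p ^ a" if t: "t \<in> carrier G" for t
  proof (rule only_prime_divisor_imp_power[OF p ord_pos[OF t]])
    fix q assume q: "Factorial_Ring.prime q" "q dvd ord t"
    then obtain k where k: "ord t = q * k" by blast
    then have "k < ord t" "k > 0" using ord_pos[OF t] prime_gt_1_nat[OF q(1)] by auto
    then have "t [^] k \<noteq> \<one>" using pow_eq_id[OF t, of k] by (auto dest: dvd_imp_le)
    then obtain j :: nat where j: "(t [^] k) [^] j = c" using soc t by blast
    have "c [^] q = t [^] (k * j * q)" using j t by (metis nat_pow_pow)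
    also have "k * j * q = ord t * j" using k by simp
    also have "t [^] (ord t * j) = \<one>" using t pow_eq_id by simp
    finally have "p dvd q" using pow_eq_id[OF c(1)] ordc by simp
    then show "q = p" using p q(1) primes_dvd_imp_eq by metis
  qed
  obtain s where s: "s \<in> carrier G" "\<And>t. t \<in> carrier G \<Longrightarrow> ord t \<le> ord s"
  proof -
    have fin: "finite (ord ` carrier G)" by (rule finite_subset[of _ "{..n}"]) (use ord_le in auto)
    then have "Max (ord ` carrier G) \<in> ord ` carrier G" using c(1) by (intro Max_in) auto
    then obtain s where s: "s \<in> carrier G" "Max (ord ` carrier G) = ord s" by blast
    have "ord t \<le> ord s" if "t \<in> carrier G" for t
      using Max_ge[OF fin, of "ord t"] that s(2) by simp
    then show ?thesis using that s(1) by blast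
  qed
  obtain m where m: "ord s = p ^ m" using ord_pow_p s by blast
  have "p \<le> ord s" using s(2)[OF c(1)] ordc by simp
  then have m0: "m > 0" using m prime_gt_1_nat[OF p] by (cases m) auto
  obtain m' where m': "m = Suc m'" using m0 by (cases m) auto
  have "s \<noteq> \<one>" using m m0 prime_gt_1_nat[OF p] by (metis ord_id one_less_power less_irrefl)
  then obtain d :: nat where d: "s [^] d = c" using soc s by blast
  have "\<exists>j::nat. t = s [^] j" if t: "t \<in> carrier G" for t
  proof (rule ccontr)
    assume nt: "\<not> (\<exists>j::nat. t = s [^] j)"
    define Q where "Q a \<longleftrightarrow> (\<exists>j::nat. t [^] (p ^ a) = s [^] j)" for a
    obtain a0 where "ord t = p ^ a0" using ord_pow_p t by blast
    then have "t [^] (p ^ a0) = s [^] (0::nat)" using t by (metis pow_ord_eq_1 nat_pow_0)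
    then have "Q a0" unfolding Q_def by blast
    define a where "a = (LEAST a. Q a)"
    have Qa: "Q a" and Ql: "\<And>b. b < a \<Longrightarrow> \<not> Q b"
      unfolding a_def using \<open>Q a0\<close> LeastI not_less_Least by blast+
    have "\<not> Q 0" using nt t by (simp add: Q_def)
    then have "a \<noteq> 0" using Qa by metis
    then obtain b where b: "a = Suc b" using not0_implies_Suc by blast
    define u where "u = t [^] (p ^ b)"
    have u: "u \<in> carrier G" using t by (simp add: u_def)
    have nu: "u \<noteq> s [^] j" for j :: nat using Ql[of b] b by (auto simp: Q_def u_def)
    have "u [^] p = t [^] (p ^ a)" using t by (simp add: u_def nat_pow_pow b mult.commute)
    then obtain j :: nat where j: "u [^] p = s [^] j" using Qa Q_def by metis
    obtain e where e: "ord u = p ^ e" using ord_pow_p u by blast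
    have "e \<le> m" using s(2)[OF u] e m prime_gt_1_nat[OF p] by (metis power_le_imp_le_exp)
    then have "u [^] (p ^ m) = \<one>" using pow_eq_id[OF u] e by (simp add: le_imp_power_dvd)
    moreover have "u [^] (p ^ m) = (u [^] p) [^] (p ^ (m - 1))"
      using u by (simp add: nat_pow_pow m')
    moreover have "\<dots> = s [^] (j * p ^ (m - 1))" using j s by (simp add: nat_pow_pow)
    ultimately have "p ^ m dvd j * p ^ (m - 1)" using pow_eq_id[OF s(1)] m by metis
    then have "p * p ^ (m - 1) dvd j * p ^ (m - 1)" by (simp add: m')
    then have "p dvd j" using prime_gt_0_nat[OF p] by simp
    then obtain f where f: "j = p * f" by blast
    define v where "v = u \<otimes> inv (s [^] f)"
    have v: "v \<in> carrier G" using u s by (simp add: v_def)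
    have uv: "u = v \<otimes> s [^] f" using u s by (simp add: v_def m_assoc)
    have "v [^] p = u [^] p \<otimes> inv ((s [^] f) [^] p)"
      using u s by (simp add: v_def nat_pow_distrib nat_pow_inv)
    also have "(s [^] f) [^] p = u [^] p" using s j f by (simp add: nat_pow_pow mult.commute)
    finally have vp: "v [^] p = \<one>" using u by simp
    have "v \<noteq> \<one>" using uv nu[of f] s by auto
    then obtain k :: nat where k: "v [^] k = c" using soc v by blast
    have "\<not> p dvd k"
    proof
      assume "p dvd k"
      then obtain k' where "k = p * k'" by blast
      then have "v [^] k = (v [^] p) [^] k'" using v by (simp add: nat_pow_pow)
      then show False using k vp c(2) by simp
    qed
    then obtain x z where yz: "k * x = 1 + p * z" using bezout_prime[OF p, of k] by auto
    have "v = v [^] (1 + p * z)" using v vp by (simp add: nat_pow_mult[symmetric] nat_pow_pow[symmetric])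
    also have "\<dots> = v [^] (k * x)" using v vp yz[symmetric]
      by (simp add: nat_pow_mult[symmetric] nat_pow_pow[symmetric])
    also have "\<dots> = s [^] (d * x)" using v s k d by (metis nat_pow_pow)
    finally have "u = s [^] (d * x + f)" using uv s by (simp add: nat_pow_mult)
    then show False using nu by blast
  qed
  then show ?thesis using s m m0 by blast
qed

text \<open>Separating an element of order \<open>p\<close> from the identity by a cyclic quotient of \<open>p\<close>-power
  order amounts to finding a character that is nontrivial on the element. The subgroup \<open>B\<close> is
  chosen maximal among those that contain \<open>H\<close> and avoid \<open>c\<close>, so that every nontrivial subgroup
  of the quotient by \<open>B\<close> contains the class of \<open>c\<close>.\<close>
lemma (in group) cyclic_quotient_detecting_prime_order:
  fixes n p :: nat
  assumes H: "subgroup H G"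
    and comm: "\<And>a b. a \<in> carrier G \<Longrightarrow> b \<in> carrier G \<Longrightarrow> a \<otimes> b \<otimes> inv a \<otimes> inv b \<in> H"
    and n: "n > 0" "\<And>t. t \<in> carrier G \<Longrightarrow> t [^] n \<in> H"
    and p: "Factorial_Ring.prime p" and c: "c \<in> carrier G" "c \<notin> H" "c [^] p \<in> H"
  shows "\<exists>B s m. subgroup B G \<and> H \<subseteq> B \<and> c \<notin> B \<and> s \<in> carrier G \<and> m > 0 \<and>
    (\<forall>j. s [^] j \<in> B \<longleftrightarrow> p ^ m dvd j) \<and> (\<forall>t\<in>carrier G. \<exists>j::nat. \<exists>b\<in>B. t = b \<otimes> s [^] j)"
proof -
  define A where "A = {B. subgroup B G \<and> H \<subseteq> B \<and> c \<notin> B}"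
  have "\<exists>B\<in>A. \<forall>W\<in>A. B \<subseteq> W \<longrightarrow> W = B"
  proof (rule subset_Zorn_nonempty)
    show "A \<noteq> {}" using H c by (auto simp: A_def)
  next
    fix C assume C: "C \<noteq> {}" "subset.chain A C"
    have CA: "W \<in> A" if "W \<in> C" for W using C that by (auto simp: subset.chain_def)
    have ch: "W \<subseteq> Y \<or> Y \<subseteq> W" if "W \<in> C" "Y \<in> C" for W Y
      using C that by (auto simp: subset.chain_def)
    have "subgroup (\<Union>C) G"
    proof (rule subgroupI)
      show "\<Union>C \<subseteq> carrier G" using CA by (auto simp: A_def dest: subgroup.mem_carrier)
      show "\<Union>C \<noteq> {}" using C(1) CA subgroup.one_closed unfolding A_def by blast
    next
      fix a assume "a \<in> \<Union>C"
      then show "inv a \<in> \<Union>C" using CA unfolding A_def by (blast intro: subgroup.m_inv_closed)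
    next
      fix a b assume "a \<in> \<Union>C" "b \<in> \<Union>C"
      then obtain W where "W \<in> C" "a \<in> W" "b \<in> W" using ch by blast
      then show "a \<otimes> b \<in> \<Union>C" using CA unfolding A_def by (blast intro: subgroup.m_closed)
    qed
    then show "\<Union>C \<in> A" using C(1) CA by (auto simp: A_def)
  qed
  then obtain B where BA: "B \<in> A" and max: "\<forall>W\<in>A. B \<subseteq> W \<longrightarrow> W = B" by (elim bexE)
  then have B: "subgroup B G" "H \<subseteq> B" "c \<notin> B" by (auto simp: A_def)
  have Bmax: "W = B" if "subgroup W G" "H \<subseteq> W" "c \<notin> W" "B \<subseteq> W" for W
    using max that by (simp add: A_def)
  interpret B: subgroup B G by fact
  have conjB: "a \<otimes> b \<otimes> inv a \<in> B" if "a \<in> carrier G" "b \<in> B" for a b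
  proof -
    have "a \<otimes> b \<otimes> inv a = (a \<otimes> b \<otimes> inv a \<otimes> inv b) \<otimes> b"
      using that B.mem_carrier by (simp add: m_assoc)
    moreover have "a \<otimes> b \<otimes> inv a \<otimes> inv b \<in> B"
      using comm[of a b] that B(2) B.mem_carrier by blast
    ultimately show ?thesis using that(2) by (metis B.m_closed)
  qed
  then have "B \<lhd> G" by (simp add: normal_inv_iff B(1))
  then interpret N: normal B G .
  define Q where "Q = G Mod B"
  have Qc: "carrier Q = (\<lambda>a. B #> a) ` carrier G" by (simp add: Q_def carrier_FactGroup)
  have Q1: "\<one>\<^bsub>Q\<^esub> = B" by (simp add: Q_def)
  have Qpow: "(B #> a) [^]\<^bsub>Q\<^esub> k = B #> (a [^] k)" if "a \<in> carrier G" for a and k :: nat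
    using that by (simp add: Q_def N.FactGroup_pow)
  have Qm: "(B #> a) \<otimes>\<^bsub>Q\<^esub> (B #> b) = B #> (a \<otimes> b)" if "a \<in> carrier G" "b \<in> carrier G" for a b
    using that by (simp add: Q_def N.rcos_sum)
  have Qone: "B #> a = B \<longleftrightarrow> a \<in> B" if "a \<in> carrier G" for a
    using that coset_join1[OF _ that B(1)] coset_join2[OF that B(1)] by auto
  have Qpow1: "(B #> a) [^]\<^bsub>Q\<^esub> k = \<one>\<^bsub>Q\<^esub> \<longleftrightarrow> a [^] k \<in> B" if "a \<in> carrier G" for a and k :: nat
    using that by (simp add: Qpow Q1 Qone)
  have Qeq: "\<exists>x\<in>B. a = x \<otimes> b" if "a \<in> carrier G" "b \<in> carrier G" "B #> a = B #> b" for a b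
    using that rcos_self[OF that(1) B(1)] by (auto simp: r_coset_def)
  have "group Q" by (simp add: Q_def N.factorgroup_is_group)
  then interpret Q: comm_group Q
  proof (rule group.group_comm_groupI)
    fix x y assume "x \<in> carrier Q" "y \<in> carrier Q"
    then obtain a b where ab: "a \<in> carrier G" "b \<in> carrier G" "x = B #> a" "y = B #> b"
      by (auto simp: Qc)
    have "a \<otimes> b = (a \<otimes> b \<otimes> inv a \<otimes> inv b) \<otimes> (b \<otimes> a)"
    proof -
      have "inv b \<otimes> (b \<otimes> a) = a" using ab by (simp add: m_assoc[symmetric])
      then show ?thesis using ab by (simp add: m_assoc)
    qed
    then have "B #> (a \<otimes> b) = (B #> (a \<otimes> b \<otimes> inv a \<otimes> inv b)) \<otimes>\<^bsub>Q\<^esub> (B #> (b \<otimes> a))"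
      using ab Qm by (metis inv_closed m_closed)
    also have "B #> (a \<otimes> b \<otimes> inv a \<otimes> inv b) = \<one>\<^bsub>Q\<^esub>"
      using comm[OF ab(1,2)] B(2) ab Q1 Qone by auto
    finally show "x \<otimes>\<^bsub>Q\<^esub> y = y \<otimes>\<^bsub>Q\<^esub> x"
      using ab Qm \<open>group Q\<close> by (metis Qc group.is_monoid imageI m_closed monoid.l_one)
  qed
  have "\<exists>S\<in>carrier Q. \<exists>m>0. Q.ord S = p ^ m \<and> (\<forall>T\<in>carrier Q. \<exists>j::nat. T = S [^]\<^bsub>Q\<^esub> j)"
  proof (rule Q.cyclic_if_socle_simple[OF n(1) _ p])
    show "T [^]\<^bsub>Q\<^esub> n = \<one>\<^bsub>Q\<^esub>" if "T \<in> carrier Q" for T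
      using that n(2) B(2) unfolding Qc by (elim imageE) (simp add: Qpow1 subsetD)
    show "B #> c \<in> carrier Q" using c by (simp add: Qc)
    show "B #> c \<noteq> \<one>\<^bsub>Q\<^esub>" using c B by (simp add: Q1 Qone)
    show "(B #> c) [^]\<^bsub>Q\<^esub> p = \<one>\<^bsub>Q\<^esub>" using c(1,3) B(2) by (simp add: Qpow1 subsetD)
  next
    fix T assume T: "T \<in> carrier Q" "T \<noteq> \<one>\<^bsub>Q\<^esub>"
    then obtain t where t: "t \<in> carrier G" "T = B #> t" by (auto simp: Qc)
    \<comment> \<open>\<open>W\<close> is the subgroup generated by \<open>B\<close> and \<open>t\<close>; by maximality of \<open>B\<close> it contains \<open>c\<close>.\<close>
    define W where "W = {g \<in> carrier G. \<exists>j::nat. B #> g = T [^]\<^bsub>Q\<^esub> j}"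
    have Tn: "T [^]\<^bsub>Q\<^esub> n = \<one>\<^bsub>Q\<^esub>" using t n(2) B(2) by (simp add: Qpow1 subsetD)
    have W: "subgroup W G"
    proof (rule subgroupI)
      show "W \<subseteq> carrier G" by (auto simp: W_def)
      have "t \<in> W" using t T by (auto simp: W_def intro!: exI[of _ "1::nat"])
      then show "W \<noteq> {}" by blast
    next
      fix a assume "a \<in> W"
      then obtain j :: nat where a: "a \<in> carrier G" "B #> a = T [^]\<^bsub>Q\<^esub> j" by (auto simp: W_def)
      have "inv a \<in> carrier G" using a by simp
      have "(B #> inv a) \<otimes>\<^bsub>Q\<^esub> T [^]\<^bsub>Q\<^esub> j = \<one>\<^bsub>Q\<^esub>"
        using a Qm[of "inv a" a] by (simp add: Q1 Qone)
      \<comment> \<open>\<open>n\<close> is an exponent of the quotient, so the natural number \<open>n * j - j\<close> stands for \<open>- j\<close>.\<close>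
      moreover have "T [^]\<^bsub>Q\<^esub> (n * j - j) \<otimes>\<^bsub>Q\<^esub> T [^]\<^bsub>Q\<^esub> j = \<one>\<^bsub>Q\<^esub>"
        using T(1) n(1) Tn by (simp add: Q.nat_pow_mult Q.nat_pow_pow[symmetric])
      ultimately have "B #> inv a = T [^]\<^bsub>Q\<^esub> (n * j - j)"
        using T(1) \<open>inv a \<in> carrier G\<close>
        by (metis Q.nat_pow_closed Q.right_cancel Qc imageI)
      then show "inv a \<in> W" using a by (auto simp: W_def)
    next
      fix a b assume "a \<in> W" "b \<in> W"
      then obtain j k :: nat where ab: "a \<in> carrier G" "B #> a = T [^]\<^bsub>Q\<^esub> j"
          "b \<in> carrier G" "B #> b = T [^]\<^bsub>Q\<^esub> k" by (auto simp: W_def)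
      then have "B #> (a \<otimes> b) = T [^]\<^bsub>Q\<^esub> (j + k)"
        using T(1) Qm[of a b] by (simp add: Q.nat_pow_mult)
      then show "a \<otimes> b \<in> W" using ab unfolding W_def by blast
    qed
    have BX: "B \<subseteq> W"
    proof
      fix b assume b: "b \<in> B"
      then have "B #> b = T [^]\<^bsub>Q\<^esub> (0::nat)" using Q1 Qone B.mem_carrier by simp
      then show "b \<in> W" unfolding W_def using b B.mem_carrier by blast
    qed
    have "t \<in> W" using t T by (auto simp: W_def intro!: exI[of _ "1::nat"])
    moreover have "t \<notin> B" using T t Q1 Qone by auto
    ultimately have "W \<noteq> B" by blast
    then have "c \<in> W" using Bmax[OF W] B(2) BX by blast
    then show "\<exists>j::nat. T [^]\<^bsub>Q\<^esub> j = B #> c" unfolding W_def by fastforce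
  qed
  then obtain S m where S: "S \<in> carrier Q" "m > 0" "Q.ord S = p ^ m"
      "\<And>T. T \<in> carrier Q \<Longrightarrow> \<exists>j::nat. T = S [^]\<^bsub>Q\<^esub> j" by blast
  obtain s where s: "s \<in> carrier G" "S = B #> s" using S(1) by (auto simp: Qc)
  have "s [^] j \<in> B \<longleftrightarrow> p ^ m dvd j" for j :: nat
    using Q.pow_eq_id[OF S(1), of j] s S(3) by (simp add: Qpow Q1 Qone)
  moreover have "\<exists>j::nat. \<exists>b\<in>B. t = b \<otimes> s [^] j" if "t \<in> carrier G" for t
    using S(4)[of "B #> t"] that s Qpow Qeq[OF that] by (metis Qc imageI nat_pow_closed)
  ultimately show ?thesis using B S(2) s(1) by blast
qed

section \<open>The Galois group and the Krull topology\<close>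

lemma mem_Gal_iff: "g \<in> carrier (Gal i) \<longleftrightarrow> ring_map g \<and> bij g \<and> (\<forall>a. g (i a) = i a)"
  by (simp add: Gal_def field_embedding_ring_map)

lemma Gal_mult [simp]: "g \<otimes>\<^bsub>Gal i\<^esub> h = g \<circ> h"
  and Gal_one [simp]: "\<one>\<^bsub>Gal i\<^esub> = id"
  by (simp_all add: Gal_def)

lemma Gal_inverse_closed:
  assumes "g \<in> carrier (Gal i)"
  shows "inv_into UNIV g \<in> carrier (Gal i)"
proof -
  have g: "ring_map g" "bij g" "\<And>a. g (i a) = i a" using assms by (auto simp: mem_Gal_iff)
  have gi: "g (inv_into UNIV g x) = x" for x
    using g(2) by (simp add: bij_is_surj surj_f_inv_f)
  have ig: "inv_into UNIV g (g x) = x" for x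
    using g(2) by (simp add: bij_is_inj inv_f_f)
  have "ring_map (inv_into UNIV g)"
    unfolding ring_map_def
  proof (intro conjI allI)
    show "inv_into UNIV g 1 = 1" using ig[of 1] g(1) by (simp add: ring_map_1)
    show "inv_into UNIV g (x + y) = inv_into UNIV g x + inv_into UNIV g y" for x y
      using ig[of "inv_into UNIV g x + inv_into UNIV g y"] g(1) by (simp add: ring_map_add gi)
    show "inv_into UNIV g (x * y) = inv_into UNIV g x * inv_into UNIV g y" for x y
      using ig[of "inv_into UNIV g x * inv_into UNIV g y"] g(1) by (simp add: ring_map_mult gi)
  qed
  moreover have "bij (inv_into UNIV g)" using g(2) by (rule bij_imp_bij_inv)
  moreover have "inv_into UNIV g (i a) = i a" for a using ig[of "i a"] g(3) by simp
  ultimately show ?thesis by (simp add: mem_Gal_iff)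
qed

lemma Gal_comp_closed:
  "g \<in> carrier (Gal i) \<Longrightarrow> h \<in> carrier (Gal i) \<Longrightarrow> g \<circ> h \<in> carrier (Gal i)"
  by (simp add: mem_Gal_iff bij_comp ring_map_def)

lemma group_Gal: "group (Gal i)"
proof (rule groupI)
  show "g \<otimes>\<^bsub>Gal i\<^esub> h \<in> carrier (Gal i)" if "g \<in> carrier (Gal i)" "h \<in> carrier (Gal i)" for g h
    using that by (simp add: mem_Gal_iff bij_comp ring_map_def)
  show "\<one>\<^bsub>Gal i\<^esub> \<in> carrier (Gal i)" by (simp add: mem_Gal_iff ring_map_def)
  show "\<exists>h\<in>carrier (Gal i). h \<otimes>\<^bsub>Gal i\<^esub> g = \<one>\<^bsub>Gal i\<^esub>" if "g \<in> carrier (Gal i)" for g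
    using Gal_inverse_closed[OF that] that
    by (auto simp: mem_Gal_iff bij_is_inj intro!: bexI[of _ "inv_into UNIV g"])
qed (auto simp: comp_assoc)

lemma Gal_inv:
  assumes "g \<in> carrier (Gal i)" shows "m_inv (Gal i) g = inv_into UNIV g"
proof (rule group.inv_equality[OF group_Gal _ assms Gal_inverse_closed[OF assms]])
  show "inv_into UNIV g \<otimes>\<^bsub>Gal i\<^esub> g = \<one>\<^bsub>Gal i\<^esub>"
    using assms by (simp add: mem_Gal_iff bij_is_inj)
qed

lemma Gal_inv_apply:
  assumes "g \<in> carrier (Gal i)"
  shows "m_inv (Gal i) g (g x) = x" "g (m_inv (Gal i) g x) = x"
  using assms by (simp_all add: Gal_inv mem_Gal_iff bij_is_inj bij_is_surj surj_f_inv_f inv_f_f)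

lemma Gal_pow: "g [^]\<^bsub>Gal i\<^esub> (n::nat) = g ^^ n"
proof (induction n)
  case (Suc n)
  then show ?case by (simp add: nat_pow_def Gal_def funpow_Suc_right del: funpow.simps)
qed (simp add: nat_pow_def Gal_def)

lemma lcoset_fixing_subgroup:
  assumes "g \<in> carrier (Gal i)"
  shows "g <#\<^bsub>Gal i\<^esub> fixing_subgroup i E = {h \<in> carrier (Gal i). \<forall>x\<in>E. h x = g x}" (is "?L = ?R")
proof (intro subset_antisym subsetI)
  interpret group "Gal i" by (rule group_Gal)
  show "h \<in> ?R" if "h \<in> ?L" for h
    using that m_closed[OF assms] by (auto simp: l_coset_def fixing_subgroup_def)
  fix h assume h: "h \<in> ?R"
  then have "m_inv (Gal i) g \<circ> h \<in> carrier (Gal i)" using assms m_closed[of "m_inv (Gal i) g" h] by simp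
  moreover have "(m_inv (Gal i) g \<circ> h) x = x" if "x \<in> E" for x
    using that h Gal_inv_apply(1)[OF assms] by simp
  moreover have "g \<circ> (m_inv (Gal i) g \<circ> h) = h"
    by (auto simp: fun_eq_iff Gal_inv_apply(2)[OF assms])
  ultimately show "h \<in> ?L" by (force simp: l_coset_def fixing_subgroup_def)
qed

lemma nonzero_const_coeff_if_irreducible:
  assumes i: "ring_map (i :: 'f::field \<Rightarrow> 'k::field)"
    and p: "Factorial_Ring.irreducible p" "poly (map_poly i p) y = 0" and y: "y \<noteq> 0"
  shows "\<exists>c r. p = pCons c r \<and> c \<noteq> 0"
proof -
  obtain c r where pc: "p = pCons c r" by (cases p)
  have "c \<noteq> 0"
  proof
    assume "c = 0"
    then have pX: "p = [:0, 1:] * r" using pc by simp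
    moreover have "\<not> is_unit [:0, 1 :: 'f:]" by (simp add: is_unit_poly_iff)
    ultimately have "is_unit r" using p(1) Factorial_Ring.irreducibleD by blast
    then obtain d where d: "r = [:d:]" "d \<noteq> 0" by (auto simp: is_unit_poly_iff dvd_field_iff)
    have "poly (map_poly i p) y = y * i d"
      by (simp add: pX d map_poly_pCons ring_map_0[OF i])
    moreover have "i d \<noteq> 0" using ring_map_inj[OF i] d ring_map_0[OF i] by (metis injD)
    ultimately show False using p(2) y by simp
  qed
  then show ?thesis using pc by blast
qed

text \<open>The subextension is \<open>F[x]\<close>. An element \<open>y\<noteq>0\<close> of it is itself algebraic, and an irreducible
  polynomial that annihilates \<open>y\<close> has a nonzero constant coefficient, which exhibits the inverse
  of \<open>y\<close> as a polynomial in \<open>y\<close>. The powers of \<open>x\<close> below the degree of an annihilating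
  polynomial span \<open>F[x]\<close>.\<close>
lemma finite_subextension_containing:
  fixes i :: "'f::field \<Rightarrow> 'k::field"
  assumes i: "field_embedding i" and alg: "\<And>x. separable_over i x"
  shows "\<exists>E. finite_subextension i E \<and> x \<in> E"
proof -
  have ri: "ring_map i" using i by (simp add: field_embedding_ring_map)
  note rm = ring_map_map_poly[OF ri]
  define ev where "ev q = poly (map_poly i q) x" for q
  have ev_add: "ev (p + q) = ev p + ev q" and ev_mult: "ev (p * q) = ev p * ev q"
    and ev_uminus: "ev (- p) = - ev p" for p q
    using rm by (simp_all add: ev_def ring_map_simps)
  have ev_const: "ev [:a:] = i a" for a
    by (simp add: ev_def map_poly_pCons ring_map_0[OF ri])
  have ev_eval: "poly (map_poly i q) (ev r) \<in> range ev" for q r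
  proof (induction q)
    case 0
    then show ?case using ev_const[of 0] ring_map_0[OF ri] by (auto intro: range_eqI[of _ _ 0])
  next
    case (pCons a q)
    then obtain s where "poly (map_poly i q) (ev r) = ev s" by auto
    then have "poly (map_poly i (pCons a q)) (ev r) = ev ([:a:] + r * s)"
      by (simp add: map_poly_pCons ring_map_0[OF ri] ev_add ev_mult ev_const)
    then show ?case by blast
  qed
  define E where "E = range ev"
  have "inverse y \<in> E" if yE: "y \<in> E" for y
  proof (cases "y = 0")
    case False
    obtain p where p: "Factorial_Ring.irreducible p" "poly (map_poly i p) y = 0"
      using alg[of y] by (auto simp: separable_over_def)
    then obtain c r where cr: "p = pCons c r" "c \<noteq> 0"
      using nonzero_const_coeff_if_irreducible[OF ri p False] by blast
    obtain q where q: "y = ev q" using yE by (auto simp: E_def)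
    obtain s where s: "poly (map_poly i r) y = ev s" using ev_eval[of r q] q by auto
    have "i c + y * ev s = 0"
      using p(2) cr by (simp add: map_poly_pCons ring_map_0[OF ri] s)
    then have ys: "y * ev s = - i c" by (simp add: eq_neg_iff_add_eq_0 add.commute)
    have ic: "i c \<noteq> 0" using ring_map_inj[OF ri] cr(2) ring_map_0[OF ri] by (metis injD)
    have "y * (- ev s * inverse (i c)) = - (y * ev s) * inverse (i c)" by (simp add: mult.assoc)
    also have "\<dots> = 1" unfolding ys using ic by simp
    finally have "y * (- ev s * inverse (i c)) = 1" .
    then have "inverse y = - ev s * inverse (i c)" by (rule inverse_unique)
    also have "\<dots> = ev (- s * [:inverse c:])"
      unfolding ev_mult ev_uminus ev_const ring_map_inverse[OF ri] by simp
    finally show ?thesis by (simp add: E_def)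
  qed (use yE in simp)
  moreover have "range i \<subseteq> E" using ev_const by (auto simp: E_def) (metis rangeI)
  ultimately have inter: "intermediate_field i E"
    unfolding intermediate_field_def
  proof (intro conjI ballI)
    fix y z assume "y \<in> E" "z \<in> E"
    then obtain q r where "y = ev q" "z = ev r" by (auto simp: E_def)
    then have "y + z = ev (q + r)" "y * z = ev (q * r)" by (simp_all add: ev_add ev_mult)
    then show "y + z \<in> E" "y * z \<in> E" by (simp_all add: E_def)
  next
    fix y assume "y \<in> E"
    then obtain q where "y = ev q" by (auto simp: E_def)
    then have "- y = ev (- q)" by (simp add: ev_uminus)
    then show "- y \<in> E" by (simp add: E_def)
  qed
  obtain p where p: "Factorial_Ring.irreducible p" "poly (map_poly i p) x = 0"
    using alg[of x] by (auto simp: separable_over_def)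
  define d where "d = Polynomial.degree p"
  have p0: "p \<noteq> 0" using p(1) by auto
  have "d > 0"
  proof (rule ccontr)
    assume "\<not> d > 0"
    then have "is_unit p" using p0 by (simp add: d_def is_unit_iff_degree)
    then show False using p(1) by (simp add: Factorial_Ring.irreducible_def)
  qed
  define B where "B = (\<lambda>j. x ^ j) ` {..<d}"
  have "\<exists>c. y = (\<Sum>b\<in>B. i (c b) * b)" if y: "y \<in> E" for y
  proof -
    obtain q where q: "y = ev q" using y by (auto simp: E_def)
    define r where "r = q mod p"
    have "q = q div p * p + r" by (simp add: r_def)
    then have "ev q = ev (q div p) * ev p + ev r" by (metis ev_add ev_mult)
    then have yr: "y = ev r" using p(2) q by (simp add: ev_def)
    have deg: "Polynomial.degree r < d"
      using degree_mod_less[OF p0, of q] \<open>d > 0\<close> by (auto simp: r_def d_def)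
    define h where "h j = i (Polynomial.coeff r j) * x ^ j" for j
    have "Polynomial.degree (map_poly i r) \<le> Polynomial.degree r" by (rule map_poly_degree_leq)
    then have "y = (\<Sum>j<d. h j)"
      unfolding yr ev_def poly_altdef h_def coeff_map_poly_ring_map[OF ri, symmetric]
      using deg by (intro sum.mono_neutral_left) (auto intro: coeff_eq_0)
    also have "\<dots> = (\<Sum>b\<in>B. sum h {j\<in>{..<d}. x ^ j = b})"
      unfolding B_def by (rule sum.image_gen) simp
    also have "\<dots> = (\<Sum>b\<in>B. i (\<Sum>j | j \<in> {..<d} \<and> x ^ j = b. Polynomial.coeff r j) * b)"
      by (rule sum.cong) (auto simp: ring_map_sum[OF ri] sum_distrib_right h_def intro!: sum.cong)
    finally show ?thesis
      by (intro exI[of _ "\<lambda>b. \<Sum>j | j \<in> {..<d} \<and> x ^ j = b. Polynomial.coeff r j"])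
  qed
  moreover have "B \<subseteq> E"
  proof -
    have "ev [:0, 1:] = x" by (simp add: ev_def map_poly_pCons ring_map_simps ri)
    moreover have "ev (q ^ j) = ev q ^ j" for q j
      by (induction j) (simp_all add: ev_mult ev_const ring_map_1[OF ri] one_pCons)
    ultimately show ?thesis unfolding B_def E_def by (metis image_subsetI rangeI)
  qed
  moreover have "finite B" by (simp add: B_def)
  ultimately have "finite_subextension i E" using inter unfolding finite_subextension_def by blast
  moreover have "x \<in> E"
    unfolding E_def by (rule range_eqI[of _ _ "[:0, 1:]"]) (simp add: ev_def map_poly_pCons ring_map_simps ri)
  ultimately show ?thesis by blast
qed

lemma finite_orbit_Gal:
  fixes i :: "'f::field \<Rightarrow> 'k::field"
  assumes i: "field_embedding i" and alg: "separable_over i x"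
  shows "finite ((\<lambda>g. g x) ` carrier (Gal i))"
proof -
  have ri: "ring_map i" using i by (simp add: field_embedding_ring_map)
  obtain p where p: "Factorial_Ring.irreducible p" "poly (map_poly i p) x = 0"
    using alg by (auto simp: separable_over_def)
  have "map_poly i p \<noteq> 0"
    using p(1) ring_map_inj[OF ri] ring_map_0[OF ri] map_poly_eq_0_iff[of i p]
    by (metis Factorial_Ring.not_irreducible_zero injD)
  then have "finite {y. poly (map_poly i p) y = 0}" by (rule poly_roots_finite)
  moreover have "poly (map_poly i p) (g x) = 0" if "g \<in> carrier (Gal i)" for g
  proof -
    have g: "ring_map g" "\<And>a. g (i a) = i a" using that by (auto simp: mem_Gal_iff)
    have "map_poly g (map_poly i p) = map_poly i p"
      by (simp add: poly_eq_iff coeff_map_poly_ring_map g ri)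
    then show ?thesis using poly_map_poly[OF g(1), of "map_poly i p" x] p(2) ring_map_0[OF g(1)] by simp
  qed
  ultimately show ?thesis by (auto elim: finite_subset[rotated])
qed

text \<open>The Krull topology is the topology of pointwise convergence on the discrete field. This
  form needs no composite of subextensions, because finite sets of elements can simply be
  united.\<close>
lemma openin_krull_topology:
  fixes i :: "'f::field \<Rightarrow> 'k::field"
  assumes i: "field_embedding i" and alg: "\<And>x. separable_over i x"
  shows "openin (krull_topology i) U \<longleftrightarrow> U \<subseteq> carrier (Gal i) \<and>
    (\<forall>g\<in>U. \<exists>B. finite B \<and> (\<forall>h\<in>carrier (Gal i). (\<forall>b\<in>B. h b = g b) \<longrightarrow> h \<in> U))"
    (is "?L \<longleftrightarrow> ?R U")
proof
  define \<B> where "\<B> = {g <#\<^bsub>Gal i\<^esub> fixing_subgroup i E | g E. g \<in> carrier (Gal i) \<and> finite_subextension i E}"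
  assume ?L
  then have "generate_topology_on \<B> U"
    by (simp add: krull_topology_def openin_topology_generated_by_iff \<B>_def)
  then show "?R U"
  proof induction
    case Empty
    then show ?case by simp
  next
    case (Int a b)
    show ?case
    proof (intro conjI ballI)
      show "a \<inter> b \<subseteq> carrier (Gal i)" using Int by blast
      fix g assume "g \<in> a \<inter> b"
      then obtain A B where "finite A" "\<forall>h\<in>carrier (Gal i). (\<forall>b\<in>A. h b = g b) \<longrightarrow> h \<in> a"
        "finite B" "\<forall>h\<in>carrier (Gal i). (\<forall>b\<in>B. h b = g b) \<longrightarrow> h \<in> b" using Int by blast
      then show "\<exists>C. finite C \<and> (\<forall>h\<in>carrier (Gal i). (\<forall>b\<in>C. h b = g b) \<longrightarrow> h \<in> a \<inter> b)"
        by (intro exI[of _ "A \<union> B"]) auto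
    qed
  next
    case (UN K)
    then show ?case by (intro conjI) (blast, meson UnionE UnionI)
  next
    case (Basis s)
    then obtain g E where gE: "g \<in> carrier (Gal i)" "finite_subextension i E"
        "s = {h \<in> carrier (Gal i). \<forall>x\<in>E. h x = g x}"
      by (auto simp: \<B>_def lcoset_fixing_subgroup)
    obtain B where B: "finite B" "B \<subseteq> E" "\<forall>x\<in>E. \<exists>c. x = (\<Sum>b\<in>B. i (c b) * b)"
      using gE(2) by (auto simp: finite_subextension_def)
    show ?case
    proof (intro conjI ballI exI[of _ B] impI)
      show "s \<subseteq> carrier (Gal i)" using gE by auto
      show "finite B" by fact
      fix k h assume k: "k \<in> s" and h: "h \<in> carrier (Gal i)" and eq: "\<forall>b\<in>B. h b = k b"
      have k': "k \<in> carrier (Gal i)" using k gE by auto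
      have "h x = k x" if "x \<in> E" for x
      proof -
        obtain c where c: "x = (\<Sum>b\<in>B. i (c b) * b)" using B(3) \<open>x \<in> E\<close> by blast
        show ?thesis
          unfolding c using h k' eq by (auto simp: mem_Gal_iff ring_map_sum ring_map_mult intro!: sum.cong)
      qed
      then show "h \<in> s" using k h gE(3) by auto
    qed
  qed
next
  assume R: "?R U"
  show ?L
  proof (subst openin_subopen, rule ballI)
    fix g assume g: "g \<in> U"
    then have g': "g \<in> carrier (Gal i)" using R by blast
    have "\<exists>B. finite B \<and> (\<forall>h\<in>carrier (Gal i). (\<forall>b\<in>B. h b = g b) \<longrightarrow> h \<in> U)"
      using conjunct2[OF R] g by (rule bspec)
    then obtain B where B: "finite B" "\<forall>h\<in>carrier (Gal i). (\<forall>b\<in>B. h b = g b) \<longrightarrow> h \<in> U"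
      by (elim exE conjE)
    have open_coset: "\<exists>V. openin (krull_topology i) V \<and> g \<in> V \<and> V \<subseteq> carrier (Gal i) \<and> (\<forall>h\<in>V. h x = g x)" for x
    proof -
      obtain E where E: "finite_subextension i E" "x \<in> E"
        using finite_subextension_containing[OF i alg] by blast
      have "openin (krull_topology i) (g <#\<^bsub>Gal i\<^esub> fixing_subgroup i E)"
        unfolding krull_topology_def by (rule topology_generated_by_Basis) (use g' E in blast)
      then show ?thesis unfolding lcoset_fixing_subgroup[OF g'] using g' E(2) by blast
    qed
    have "\<exists>V. openin (krull_topology i) V \<and> g \<in> V \<and> V \<subseteq> carrier (Gal i) \<and> (\<forall>h\<in>V. \<forall>b\<in>B. h b = g b)"
      using B(1)
    proof (induction B)
      case empty
      then show ?case using open_coset[of 0] by blast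
    next
      case (insert x B)
      then obtain V where V: "openin (krull_topology i) V" "g \<in> V" "V \<subseteq> carrier (Gal i)" "\<forall>h\<in>V. \<forall>b\<in>B. h b = g b"
        by blast
      obtain V' where V': "openin (krull_topology i) V'" "g \<in> V'" "V' \<subseteq> carrier (Gal i)" "\<forall>h\<in>V'. h x = g x"
        using open_coset by blast
      have "\<forall>h\<in>V \<inter> V'. \<forall>b\<in>insert x B. h b = g b" using V(4) V'(4) by simp
      moreover have "V \<inter> V' \<subseteq> carrier (Gal i)" "g \<in> V \<inter> V'" using V(2,3) V'(2) by auto
      ultimately show ?case using openin_Int[OF V(1) V'(1)] by (intro exI conjI)
    qed
    then obtain V where V: "openin (krull_topology i) V" "g \<in> V" "V \<subseteq> carrier (Gal i)" "\<forall>h\<in>V. \<forall>b\<in>B. h b = g b"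
      by (elim exE conjE)
    have "V \<subseteq> U" using B(2) V(3,4) by (meson subsetD subsetI)
    then show "\<exists>T. openin (krull_topology i) T \<and> g \<in> T \<and> T \<subseteq> U" using V(1,2) by (intro exI conjI)
  qed
qed

lemma krull_neighbourhood:
  fixes i :: "'f::field \<Rightarrow> 'k::field"
  assumes i: "field_embedding i" and alg: "\<And>x. separable_over i x"
    and U: "openin (krull_topology i) U" "g \<in> U"
  obtains B where "finite B" "\<forall>h\<in>carrier (Gal i). (\<forall>b\<in>B. h b = g b) \<longrightarrow> h \<in> U"
proof -
  have "\<forall>g\<in>U. \<exists>B. finite B \<and> (\<forall>h\<in>carrier (Gal i). (\<forall>b\<in>B. h b = g b) \<longrightarrow> h \<in> U)"
    using U(1) openin_krull_topology[OF i alg] by (rule_tac conjunct2) (rule iffD1)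
  from bspec[OF this U(2)] show ?thesis using that by (elim exE conjE)
qed

lemma topspace_krull_topology:
  fixes i :: "'f::field \<Rightarrow> 'k::field"
  assumes i: "field_embedding i" and alg: "\<And>x. separable_over i x"
  shows "topspace (krull_topology i) = carrier (Gal i)"
proof
  show "topspace (krull_topology i) \<subseteq> carrier (Gal i)"
    by (rule conjunct1[OF iffD1[OF openin_krull_topology[OF i alg] openin_topspace]])
  have "openin (krull_topology i) (carrier (Gal i))"
    unfolding openin_krull_topology[OF i alg] by (auto intro: exI[of _ "{}"])
  then show "carrier (Gal i) \<subseteq> topspace (krull_topology i)" by (rule openin_subset)
qed

lemma openin_agree:
  fixes i :: "'f::field \<Rightarrow> 'k::field"
  assumes i: "field_embedding i" and alg: "\<And>x. separable_over i x" and B: "finite B"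
  shows "openin (krull_topology i) {h \<in> carrier (Gal i). \<forall>b\<in>B. h b = g b}"
  unfolding openin_krull_topology[OF i alg] using B by auto

lemma hausdorff_topological_group_Gal:
  fixes i :: "'f::field \<Rightarrow> 'k::field"
  assumes i: "field_embedding i" and alg: "\<And>x. separable_over i x"
  shows "hausdorff_topological_group (Gal i) (krull_topology i)"
proof -
  interpret group "Gal i" by (rule group_Gal)
  note ts = topspace_krull_topology[OF i alg]
  note agree = openin_agree[OF i alg]
  show ?thesis
  proof unfold_locales
    show "topspace (krull_topology i) = carrier (Gal i)" by (rule ts)
    show "continuous_map (prod_topology (krull_topology i) (krull_topology i)) (krull_topology i)
        (\<lambda>(x, y). x \<otimes>\<^bsub>Gal i\<^esub> y)"
      unfolding continuous_map_def
    proof (intro conjI allI impI)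
      show "(\<lambda>(x, y). x \<otimes>\<^bsub>Gal i\<^esub> y) \<in> topspace (prod_topology (krull_topology i) (krull_topology i))
          \<rightarrow> topspace (krull_topology i)"
        using Gal_comp_closed by (force simp: ts)
      fix U assume U: "openin (krull_topology i) U"
      show "openin (prod_topology (krull_topology i) (krull_topology i))
          {x \<in> topspace (prod_topology (krull_topology i) (krull_topology i)).
            (case x of (x, y) \<Rightarrow> x \<otimes>\<^bsub>Gal i\<^esub> y) \<in> U}" (is "openin _ ?P")
        unfolding openin_prod_topology_alt
      proof (intro allI impI)
        fix g h assume "(g, h) \<in> ?P"
        then have gh: "g \<in> carrier (Gal i)" "h \<in> carrier (Gal i)" "g \<circ> h \<in> U" by (auto simp: ts)
        obtain B where B: "finite B" "\<forall>k\<in>carrier (Gal i). (\<forall>b\<in>B. k b = (g \<circ> h) b) \<longrightarrow> k \<in> U"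
          by (rule krull_neighbourhood[OF i alg U gh(3)])
        let ?V = "{k \<in> carrier (Gal i). \<forall>b\<in>h ` B. k b = g b}"
        let ?W = "{k \<in> carrier (Gal i). \<forall>b\<in>B. k b = h b}"
        have "?V \<times> ?W \<subseteq> ?P"
        proof
          fix q assume "q \<in> ?V \<times> ?W"
          then obtain v w where q: "q = (v, w)" and vw: "v \<in> carrier (Gal i)" "\<forall>b\<in>h ` B. v b = g b"
            "w \<in> carrier (Gal i)" "\<forall>b\<in>B. w b = h b" by blast
          have "v \<circ> w \<in> U" using B(2) vw Gal_comp_closed[OF vw(1,3)] by simp
          then show "q \<in> ?P" using q vw(1,3) by (simp add: ts)
        qed
        moreover have "openin (krull_topology i) ?V" "openin (krull_topology i) ?W"
          by (rule agree; simp add: B(1))+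
        moreover have "g \<in> ?V" "h \<in> ?W" using gh by auto
        ultimately show "\<exists>V W. openin (krull_topology i) V \<and> openin (krull_topology i) W \<and> g \<in> V \<and> h \<in> W \<and> V \<times> W \<subseteq> ?P"
          by (intro exI conjI)
      qed
    qed
    show "continuous_map (krull_topology i) (krull_topology i) (\<lambda>x. inv\<^bsub>Gal i\<^esub> x)"
      unfolding continuous_map_def
    proof (intro conjI allI impI)
      show "(\<lambda>x. inv\<^bsub>Gal i\<^esub> x) \<in> topspace (krull_topology i) \<rightarrow> topspace (krull_topology i)"
        by (auto simp: ts)
      fix U assume U: "openin (krull_topology i) U"
      show "openin (krull_topology i) {x \<in> topspace (krull_topology i). inv\<^bsub>Gal i\<^esub> x \<in> U}" (is "openin _ ?P")
      proof (subst openin_subopen, rule ballI)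
        fix g assume "g \<in> ?P"
        then have g: "g \<in> carrier (Gal i)" "inv\<^bsub>Gal i\<^esub> g \<in> U" by (auto simp: ts)
        obtain B where B: "finite B" "\<forall>k\<in>carrier (Gal i). (\<forall>b\<in>B. k b = (inv\<^bsub>Gal i\<^esub> g) b) \<longrightarrow> k \<in> U"
          by (rule krull_neighbourhood[OF i alg U g(2)])
        let ?V = "{k \<in> carrier (Gal i). \<forall>b\<in>(inv\<^bsub>Gal i\<^esub> g) ` B. k b = g b}"
        have "?V \<subseteq> ?P"
        proof
          fix k assume k: "k \<in> ?V"
          then have "k (m_inv (Gal i) g b) = b" if "b \<in> B" for b
            using that Gal_inv_apply(2)[OF g(1)] by simp
          then have "(inv\<^bsub>Gal i\<^esub> k) b = (inv\<^bsub>Gal i\<^esub> g) b" if "b \<in> B" for b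
            using that k Gal_inv_apply(1)[of k i "m_inv (Gal i) g b"] by simp
          then show "k \<in> ?P" using k B(2) by (simp add: ts)
        qed
        moreover have "openin (krull_topology i) ?V" using B(1) by (intro agree) simp
        moreover have "g \<in> ?V"
          using g(1) Gal_inv_apply(2)[OF g(1)] by simp
        ultimately show "\<exists>V. openin (krull_topology i) V \<and> g \<in> V \<and> V \<subseteq> ?P" by (intro exI conjI)
      qed
    qed
    show "Hausdorff_space (krull_topology i)"
      unfolding Hausdorff_space_def ts
    proof (intro allI impI)
      fix g h assume gh: "g \<in> carrier (Gal i) \<and> h \<in> carrier (Gal i) \<and> g \<noteq> h"
      then obtain x where x: "g x \<noteq> h x" by (auto simp: fun_eq_iff)
      let ?V = "\<lambda>g. {k \<in> carrier (Gal i). \<forall>b\<in>{x}. k b = g b}"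
      have "disjnt (?V g) (?V h)" using x by (auto simp: disjnt_iff)
      moreover have "openin (krull_topology i) (?V g)" "openin (krull_topology i) (?V h)"
        by (rule agree; simp)+
      moreover have "g \<in> ?V g" "h \<in> ?V h" using gh by auto
      ultimately show "\<exists>U V. openin (krull_topology i) U \<and> openin (krull_topology i) V \<and> g \<in> U \<and> h \<in> V \<and> disjnt U V"
        by (intro exI[of _ "?V g"] exI[of _ "?V h"] conjI)
    qed
  qed
qed

lemma closure_of_krull:
  fixes i :: "'f::field \<Rightarrow> 'k::field"
  assumes i: "field_embedding i" and alg: "\<And>x. separable_over i x"
    and D: "D \<subseteq> K" and K: "K \<subseteq> carrier (Gal i)"
  shows "(subtopology (krull_topology i) K) closure_of D =
    {g \<in> K. \<forall>B. finite B \<longrightarrow> (\<exists>d\<in>D. \<forall>b\<in>B. d b = g b)}" (is "?L = ?R")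
proof (intro subset_antisym subsetI)
  fix g assume g: "g \<in> ?L"
  then have gK: "g \<in> K" by (simp add: in_closure_of)
  have "\<exists>d\<in>D. \<forall>b\<in>B. d b = g b" if B: "finite B" for B
  proof -
    let ?U = "{h \<in> carrier (Gal i). \<forall>b\<in>B. h b = g b}"
    have op: "openin (subtopology (krull_topology i) K) (?U \<inter> K)"
      using openin_agree[OF i alg B] by (rule openin_subtopology_Int)
    have gU: "g \<in> ?U \<inter> K" using gK K by auto
    have "\<forall>W. g \<in> W \<and> openin (subtopology (krull_topology i) K) W \<longrightarrow> (\<exists>d. d \<in> D \<and> d \<in> W)"
      using g by (simp add: in_closure_of)
    from mp[OF spec[OF this] conjI[OF gU op]] have "\<exists>d. d \<in> D \<and> d \<in> ?U \<inter> K" .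
    then show ?thesis by blast
  qed
  then show "g \<in> ?R" using gK by simp
next
  fix g assume g: "g \<in> ?R"
  show "g \<in> ?L"
    unfolding in_closure_of
  proof (intro conjI allI impI)
    show "g \<in> topspace (subtopology (krull_topology i) K)"
      using g K topspace_krull_topology[OF i alg] by auto
    fix U assume "g \<in> U \<and> openin (subtopology (krull_topology i) K) U"
    then obtain V where V: "openin (krull_topology i) V" "U = V \<inter> K" "g \<in> V"
      by (auto simp: openin_subtopology)
    obtain B where "finite B" "\<forall>h\<in>carrier (Gal i). (\<forall>b\<in>B. h b = g b) \<longrightarrow> h \<in> V"
      by (rule krull_neighbourhood[OF i alg V(1,3)])
    then show "\<exists>d. d \<in> D \<and> d \<in> U" using g D K V(2) by blast
  qed
qed

section \<open>Roots of unity, eigenvectors and characters\<close>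

lemma ring_map_to_ac: "ring_map to_ac"
  by (simp add: ring_map_def)

text \<open>Over the algebraic closure \<open>X^n - 1\<close> is a product of linear factors; all its roots, with
  their multiplicities, lie in \<open>F\<close>. The exponent \<open>n\<close> may be divisible by the characteristic.\<close>
lemma unity_polynomial_splits:
  assumes "contains_all_roots_of_unity TYPE('f::field)" and n: "n > 0"
  shows "\<exists>as::'f list. (\<Prod>a\<leftarrow>as. [:- a, 1:]) = Polynomial.monom 1 n - 1"
proof -
  define P :: "'f alg_closure poly" where "P = Polynomial.monom 1 n - 1"
  have cP: "Polynomial.coeff P n = 1" using n by (simp add: P_def)
  have degP: "Polynomial.degree P = n"
  proof (rule antisym)
    show "Polynomial.degree P \<le> n"
      unfolding P_def by (rule degree_diff_le) (simp_all add: degree_monom_le)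
    show "n \<le> Polynomial.degree P" using cP by (intro le_degree) simp
  qed
  have "P \<noteq> 0" using cP by auto
  then obtain A where A: "P = Polynomial.smult (Polynomial.lead_coeff P) (\<Prod>x\<in>#A. [:-x, 1:])"
    using alg_closed_imp_factorization by blast
  obtain xs where xs: "mset xs = A" using ex_mset by blast
  have Pxs: "P = (\<Prod>x\<leftarrow>xs. [:-x, 1:])"
    using A cP degP by (simp add: xs[symmetric] prod_mset_prod_list flip: mset_map)
  have to_of: "to_ac (of_ac x) = x" if "x \<in> set xs" for x
  proof -
    have "poly P x = 0"
      unfolding Pxs using that by (induction xs) auto
    then have "x ^ n = 1" by (simp add: P_def poly_monom)
    then have "x \<in> range to_ac" using assms unfolding contains_all_roots_of_unity_def by blast
    then show ?thesis by (rule to_ac_of_ac)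
  qed
  let ?Q = "\<Prod>a\<leftarrow>map of_ac xs. [:- a, 1 :: 'f:]"
  have "map_poly to_ac ?Q = (\<Prod>x\<leftarrow>xs. [:-x, 1:])"
    using to_of
  proof (induction xs)
    case (Cons x xs)
    then show ?case
      by (simp add: ring_map_mult[OF ring_map_map_poly[OF ring_map_to_ac]] map_poly_pCons
        del: mult_pCons_left)
  qed simp
  also have "\<dots> = map_poly to_ac (Polynomial.monom 1 n - 1)"
    unfolding Pxs[symmetric] P_def
    by (simp add: ring_map_diff[OF ring_map_map_poly[OF ring_map_to_ac]] map_poly_monom)
  finally have "Polynomial.coeff (map_poly to_ac ?Q) k
      = Polynomial.coeff (map_poly to_ac (Polynomial.monom 1 n - 1)) k" for k by simp
  then have "?Q = Polynomial.monom 1 n - 1"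
    unfolding coeff_map_poly_ring_map[OF ring_map_to_ac] to_ac_eq_iff by (rule poly_eqI)
  then show ?thesis by blast
qed

lemma root_of_unity_in_range:
  fixes i :: "'f::field \<Rightarrow> 'k::field"
  assumes ru: "contains_all_roots_of_unity TYPE('f)" and i: "ring_map i"
    and x: "n > 0" "x ^ n = 1"
  shows "x \<in> range i"
proof -
  obtain as :: "'f list" where as: "(\<Prod>a\<leftarrow>as. [:- a, 1:]) = Polynomial.monom 1 n - 1"
    using unity_polynomial_splits[OF ru x(1)] by blast
  have "poly (map_poly i (\<Prod>a\<leftarrow>as. [:- a, 1:])) x = (\<Prod>a\<leftarrow>as. x - i a)"
  proof (induction as)
    case (Cons a as)
    then show ?case
      by (simp add: ring_map_mult[OF ring_map_map_poly[OF i]] map_poly_pCons ring_map_simps i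
        del: mult_pCons_left)
  qed (simp add: ring_map_1[OF i])
  moreover have "poly (map_poly i (Polynomial.monom 1 n - 1)) x = 0"
    using x by (simp add: ring_map_diff[OF ring_map_map_poly[OF i]] map_poly_monom ring_map_simps i poly_monom)
  ultimately have "(\<Prod>a\<leftarrow>as. x - i a) = 0" using as by simp
  then show ?thesis by (auto simp: prod_list_zero_iff)
qed

text \<open>Applying the factors \<open>g - a\<close> of \<open>g^n - 1\<close> one after another to \<open>v\<close> ends in \<open>0\<close>; the last
  nonzero vector on the way is an eigenvector. No diagonalizability is required, so \<open>n\<close> may be
  divisible by the characteristic.\<close>
lemma eigenvector_if_unity_polynomial_splits:
  fixes i :: "'f::field \<Rightarrow> 'k::field" and as :: "'f list"
  assumes i: "ring_map i" and g: "ring_map g" "\<And>a. g (i a) = i a"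
    and V: "\<And>v w. v \<in> V \<Longrightarrow> w \<in> V \<Longrightarrow> v + w \<in> V" "\<And>a v. v \<in> V \<Longrightarrow> i a * v \<in> V"
      "\<And>v. v \<in> V \<Longrightarrow> g v \<in> V"
    and as: "(\<Prod>a\<leftarrow>as. [:- a, 1:]) = Polynomial.monom 1 n - 1" and n: "n > 0"
    and v: "v \<in> V" "v \<noteq> 0" "(g ^^ n) v = v"
  shows "\<exists>w\<in>V. w \<noteq> 0 \<and> (\<exists>a. g w = i a * w)"
proof -
  define N where "N = n + length as"
  \<comment> \<open>\<open>T P\<close> is the operator \<open>P(g)\<close>; the fixed bound \<open>N\<close> on the degrees makes it additive in \<open>P\<close>.\<close>
  define T where "T P y = (\<Sum>j\<le>N. i (Polynomial.coeff P j) * (g ^^ j) y)" for P y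
  have deg: "Polynomial.degree (\<Prod>a\<leftarrow>bs. [:- a, 1 :: 'f:]) = length bs" for bs
  proof (induction bs)
    case (Cons b bs)
    have "(\<Prod>a\<leftarrow>bs. [:- a, 1 :: 'f:]) \<noteq> 0" by (auto simp: prod_list_zero_iff)
    then show ?case using Cons by (simp add: degree_mult_eq del: mult_pCons_left)
  qed simp
  have fold: "length bs \<le> N \<Longrightarrow> T (\<Prod>a\<leftarrow>bs. [:- a, 1:]) y = foldr (\<lambda>a v. g v - i a * v) bs y" for bs y
  proof (induction bs)
    case Nil
    have "T 1 y = (\<Sum>j\<in>{0}. i (Polynomial.coeff 1 j) * (g ^^ j) y)"
      unfolding T_def by (rule sum.mono_neutral_right) (auto simp: ring_map_0[OF i])
    then show ?case by (simp add: ring_map_1[OF i])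
  next
    case (Cons b bs)
    define Q where "Q = (\<Prod>a\<leftarrow>bs. [:- a, 1 :: 'f:])"
    have IH: "T Q y = foldr (\<lambda>a v. g v - i a * v) bs y" using Cons by (simp add: Q_def)
    obtain N' where N': "N = Suc N'" using Cons.prems by (cases N) auto
    have cN: "Polynomial.coeff Q N = 0"
      using Cons.prems by (intro coeff_eq_0) (simp add: Q_def deg)
    have "T ([:- b, 1:] * Q) y
      = (\<Sum>j\<le>N. i (Polynomial.coeff (pCons 0 Q) j) * (g ^^ j) y) - i b * T Q y"
      unfolding T_def sum_distrib_left sum_subtractf[symmetric]
      by (rule sum.cong) (simp_all add: ring_map_simps i algebra_simps)
    also have "(\<Sum>j\<le>N. i (Polynomial.coeff (pCons 0 Q) j) * (g ^^ j) y)
        = (\<Sum>j\<le>N'. i (Polynomial.coeff Q j) * (g ^^ Suc j) y)"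
      unfolding N' sum.atMost_Suc_shift by (simp add: ring_map_0[OF i])
    also have "\<dots> = g (\<Sum>j\<le>N'. i (Polynomial.coeff Q j) * (g ^^ j) y)"
      by (simp add: ring_map_sum[OF g(1)] ring_map_mult[OF g(1)] g(2))
    also have "(\<Sum>j\<le>N'. i (Polynomial.coeff Q j) * (g ^^ j) y) = T Q y"
      using cN by (simp add: T_def N' ring_map_0[OF i])
    finally show ?case using IH by (simp add: Q_def del: mult_pCons_left)
  qed
  have "T (Polynomial.monom 1 n - 1) v = (\<Sum>j\<in>{0,n}. i (Polynomial.coeff (Polynomial.monom 1 n - 1) j) * (g ^^ j) v)"
    unfolding T_def by (rule sum.mono_neutral_right) (auto simp: ring_map_0[OF i] N_def)
  also have "\<dots> = 0" using n v(3) by (simp add: ring_map_simps i)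
  finally have "foldr (\<lambda>a v. g v - i a * v) as v = 0"
    using fold[of as v] by (simp add: as N_def)
  then show ?thesis
    using v(1,2)
  proof (induction as)
    case Nil
    then show ?case by simp
  next
    case (Cons a as)
    define u where "u = foldr (\<lambda>a v. g v - i a * v) as v"
    have "u \<in> V"
      unfolding u_def
    proof (induction as)
      case (Cons b bs)
      let ?u = "foldr (\<lambda>a v. g v - i a * v) bs v"
      have "g ?u + i (- b) * ?u \<in> V" using V Cons by blast
      then show ?case by (simp add: ring_map_uminus[OF i])
    qed (use v in simp)
    show ?case
    proof (cases "u = 0")
      case True
      then show ?thesis using Cons by (simp add: u_def)
    next
      case False
      have "g u = i a * u" using Cons.prems(1) by (simp add: u_def)
      then show ?thesis using \<open>u \<in> V\<close> False by blast
    qed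
  qed
qed

text \<open>Eigenspaces of one operator are stable under the operators that commute with it.\<close>
lemma joint_eigenvector:
  fixes i :: "'f::field \<Rightarrow> 'k::field"
  assumes ru: "contains_all_roots_of_unity TYPE('f)" and i: "ring_map i"
    and G: "\<And>g. g \<in> G \<Longrightarrow> ring_map g" "\<And>g a. g \<in> G \<Longrightarrow> g (i a) = i a"
    and F: "finite F" "F \<subseteq> G"
    and V: "\<And>v w. v \<in> V \<Longrightarrow> w \<in> V \<Longrightarrow> v + w \<in> V" "\<And>a v. v \<in> V \<Longrightarrow> i a * v \<in> V"
      "\<And>g v. g \<in> G \<Longrightarrow> v \<in> V \<Longrightarrow> g v \<in> V"
      "\<And>g h v. g \<in> G \<Longrightarrow> h \<in> G \<Longrightarrow> v \<in> V \<Longrightarrow> g (h v) = h (g v)"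
    and fo: "\<And>g v. g \<in> G \<Longrightarrow> v \<in> V \<Longrightarrow> \<exists>n>0. (g ^^ n) v = v"
    and v: "v \<in> V" "v \<noteq> 0"
  shows "\<exists>w\<in>V. w \<noteq> 0 \<and> (\<forall>g\<in>F. \<exists>a. g w = i a * w)"
  using F V fo v
proof (induction F arbitrary: V v rule: finite_induct)
  case empty
  then show ?case by blast
next
  case (insert g F)
  note V = insert.prems(2-5) and fo = insert.prems(6) and v = insert.prems(7,8)
  have g: "g \<in> G" using insert.prems(1) by blast
  obtain n where n: "n > 0" "(g ^^ n) v = v" using fo[OF g v(1)] by blast
  obtain as :: "'f list" where as: "(\<Prod>a\<leftarrow>as. [:- a, 1:]) = Polynomial.monom 1 n - 1"
    using unity_polynomial_splits[OF ru n(1)] by blast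
  obtain u a where u: "u \<in> V" "u \<noteq> 0" "g u = i a * u"
    using eigenvector_if_unity_polynomial_splits[OF i G(1)[OF g] G(2)[OF g] V(1,2) V(3)[OF g] as n(1) v n(2)]
    by blast
  define V' where "V' = {v \<in> V. g v = i a * v}"
  have "\<exists>w\<in>V'. w \<noteq> 0 \<and> (\<forall>g\<in>F. \<exists>a. g w = i a * w)"
  proof (rule insert.IH)
    show "F \<subseteq> G" using insert.prems(1) by blast
    show "v + w \<in> V'" if "v \<in> V'" "w \<in> V'" for v w
      using that V(1) by (simp add: V'_def ring_map_add[OF G(1)[OF g]] distrib_left)
    show "i b * v \<in> V'" if "v \<in> V'" for b v
      using that V(2) by (simp add: V'_def ring_map_mult[OF G(1)[OF g]] G(2)[OF g])
    show "h v \<in> V'" if "h \<in> G" "v \<in> V'" for h v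
      using that V(3)[of h v] V(4)[OF g that(1), of v]
      by (simp add: V'_def ring_map_mult[OF G(1)[OF that(1)]] G(2)[OF that(1)])
    show "h (k v) = k (h v)" if "h \<in> G" "k \<in> G" "v \<in> V'" for h k v
      using that V(4) by (simp add: V'_def)
    show "\<exists>n>0. (h ^^ n) v = v" if "h \<in> G" "v \<in> V'" for h v
      using that fo by (simp add: V'_def)
    show "u \<in> V'" "u \<noteq> 0" using u by (simp_all add: V'_def)
  qed
  then show ?case by (auto simp: V'_def)
qed

lemma nth_root_exists_if_separably_closed:
  fixes a :: "'k::field"
  assumes sc: "separably_closed TYPE('k)" and n: "n > 0" "of_nat n \<noteq> (0::'k)"
  shows "\<exists>b. b ^ n = a"
proof (cases "a = 0")
  case True
  then show ?thesis using n by (intro exI[of _ 0]) simp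
next
  case False
  define P where "P = Polynomial.monom 1 n - [:a:]"
  obtain n' where n': "n = Suc n'" using n(1) by (cases n) auto
  have "separable_poly P"
    unfolding separable_poly_def
  proof (rule coprimeI)
    fix d assume d: "d dvd P" "d dvd pderiv P"
    have "pderiv P = Polynomial.monom (of_nat n) n'"
      by (simp add: P_def pderiv_diff pderiv_monom n' pderiv_pCons)
    moreover have "Polynomial.smult (of_nat n) P - [:0, 1:] * Polynomial.monom (of_nat n) n' = [:- of_nat n * a:]"
      by (simp add: P_def n' smult_diff_right smult_monom monom_Suc algebra_simps)
    moreover have "d dvd Polynomial.smult (of_nat n) P" using d(1) by (rule dvd_smult)
    ultimately have "d dvd [:- of_nat n * a:]" using d(2) by (metis dvd_diff dvd_mult)
    moreover have "is_unit [:- of_nat n * a:]" using False n(2) by (simp add: is_unit_const_poly_iff dvd_field_iff)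
    ultimately show "is_unit d" by (rule dvd_trans)
  qed
  moreover have "Polynomial.degree P > 0"
  proof -
    have "Polynomial.coeff P n \<noteq> 0" using n(1) by (simp add: P_def n')
    then show ?thesis using le_degree[of P n] n(1) by linarith
  qed
  ultimately obtain b where "poly P b = 0" using sc unfolding separably_closed_def by blast
  then show ?thesis by (intro exI[of _ b]) (simp add: P_def poly_monom)
qed

lemma artin_schreier_root_exists:
  fixes a :: "'k::field"
  assumes sc: "separably_closed TYPE('k)" and p: "p > 1" "of_nat p = (0::'k)"
  shows "\<exists>t. t ^ p - t = a"
proof -
  define P where "P = Polynomial.monom 1 p - [:a, 1:]"
  have "pderiv P = - 1"
    using p by (simp add: P_def pderiv_diff pderiv_monom pderiv_pCons one_pCons)
  then have "is_unit (pderiv P)" by simp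
  then have "separable_poly P" unfolding separable_poly_def by (rule is_unit_right_imp_coprime)
  moreover have "Polynomial.degree P > 0"
  proof -
    have "Polynomial.coeff P p \<noteq> 0" using p(1) by (auto simp: P_def coeff_pCons split: nat.split)
    then show ?thesis using le_degree[of P p] p(1) by linarith
  qed
  ultimately obtain b where "poly P b = 0" using sc unfolding separably_closed_def by blast
  then show ?thesis by (intro exI[of _ b]) (simp add: P_def poly_monom algebra_simps)
qed

text \<open>Dedekind's independence of characters: multiplying a relation by \<open>f k y\<close> and subtracting
  it from the relation at \<open>y * x\<close> removes the term of \<open>k\<close>.\<close>
lemma dedekind_independence:
  fixes f :: "'j \<Rightarrow> 'a::monoid_mult \<Rightarrow> 'k::field"
  assumes "finite I"
    and E: "1 \<in> E" "\<And>x y. x \<in> E \<Longrightarrow> y \<in> E \<Longrightarrow> x * y \<in> E"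
    and f: "\<And>j. j \<in> I \<Longrightarrow> f j 1 = 1" "\<And>j x y. j \<in> I \<Longrightarrow> x \<in> E \<Longrightarrow> y \<in> E \<Longrightarrow> f j (x * y) = f j x * f j y"
    and dist: "\<And>j k. j \<in> I \<Longrightarrow> k \<in> I \<Longrightarrow> j \<noteq> k \<Longrightarrow> \<exists>x\<in>E. f j x \<noteq> f k x"
    and zero: "\<And>x. x \<in> E \<Longrightarrow> (\<Sum>j\<in>I. c j * f j x) = 0"
  shows "\<forall>j\<in>I. c j = 0"
  using assms(1) f dist zero
proof (induction I arbitrary: c rule: finite_induct)
  case empty
  then show ?case by simp
next
  case (insert k I)
  note f = insert.prems(1,2) and dist = insert.prems(3) and zero = insert.prems(4)
  have cI: "c j = 0" if j: "j \<in> I" for j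
  proof -
    obtain y where y: "y \<in> E" "f j y \<noteq> f k y" using dist[of j k] insert.hyps(2) j by auto
    have "\<forall>j\<in>I. c j * (f j y - f k y) = 0"
    proof (rule insert.IH)
      fix x assume x: "x \<in> E"
      have "(\<Sum>j\<in>I. c j * (f j y - f k y) * f j x)
        = (\<Sum>j\<in>insert k I. c j * f j (y * x)) - f k y * (\<Sum>j\<in>insert k I. c j * f j x)"
        using insert.hyps x y(1)
        by (simp add: f(2) sum_distrib_left sum_subtractf[symmetric] algebra_simps)
      also have "\<dots> = 0" using zero x y(1) E(2) by simp
      finally show "(\<Sum>j\<in>I. c j * (f j y - f k y) * f j x) = 0" .
    qed (use f dist in auto)
    from bspec[OF this j] show ?thesis using y(2) by simp
  qed
  have "c k = 0" using zero[OF E(1)] insert.hyps f(1) cI by simp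
  then show ?case using cI by simp
qed

lemma ring_map_funpow:
  fixes g :: "'a::comm_ring_1 \<Rightarrow> 'a"
  shows "ring_map g \<Longrightarrow> ring_map (g ^^ n)"
  by (induction n) (auto simp: ring_map_def)

section \<open>Kummer and Artin-Schreier theory for a group of automorphisms\<close>

locale galois_subgroup =
  fixes i :: "'f::field \<Rightarrow> 'k::field" and K :: "('k \<Rightarrow> 'k) set"
  assumes i: "field_embedding i" and alg: "\<And>x. separable_over i x"
    and sc: "separably_closed TYPE('k)"
    and ru: "contains_all_roots_of_unity TYPE('f)"
    and K: "subgroup K (Gal i)"
begin

lemma ri: "ring_map i"
  using i by (simp add: field_embedding_ring_map)

lemma K_Gal: "g \<in> K \<Longrightarrow> g \<in> carrier (Gal i)"
  using K by (rule subgroup.mem_carrier)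

lemma K_ring_map: "g \<in> K \<Longrightarrow> ring_map g"
  and K_fix: "g \<in> K \<Longrightarrow> g (i a) = i a"
  and K_inj: "g \<in> K \<Longrightarrow> g x = g y \<longleftrightarrow> x = y"
  using K_Gal by (auto simp: mem_Gal_iff bij_def inj_eq)

lemma K_comp: "g \<in> K \<Longrightarrow> h \<in> K \<Longrightarrow> g \<circ> h \<in> K"
  using subgroup.m_closed[OF K] by simp

lemma K_id: "id \<in> K"
  using subgroup.one_closed[OF K] by simp

lemma K_inv: "g \<in> K \<Longrightarrow> \<exists>h\<in>K. (\<forall>x. h (g x) = x) \<and> (\<forall>x. g (h x) = x)"
  using subgroup.m_inv_closed[OF K] Gal_inv_apply[OF K_Gal] by (intro bexI[of _ "m_inv (Gal i) g"]) auto

lemma K_funpow: "g \<in> K \<Longrightarrow> g ^^ n \<in> K"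
  by (induction n) (simp_all only: funpow.simps K_id K_comp)

lemmas K_simps = ring_map_simps[OF K_ring_map] K_fix

text \<open>The elements on which \<open>K\<close> acts through an abelian group. This is the fixed field of the
  commutator subgroup of \<open>K\<close>, that is, the maximal abelian extension of the fixed field of \<open>K\<close>.\<close>
definition M :: "'k set" where
  "M = {y. \<forall>g\<in>K. \<forall>h\<in>K. g (h y) = h (g y)}"

lemma M_commute: "y \<in> M \<Longrightarrow> g \<in> K \<Longrightarrow> h \<in> K \<Longrightarrow> g (h y) = h (g y)"
  by (simp add: M_def)

lemma M_add: "x \<in> M \<Longrightarrow> y \<in> M \<Longrightarrow> x + y \<in> M"
  and M_scale: "y \<in> M \<Longrightarrow> i a * y \<in> M"
  by (simp_all add: M_def K_simps)

lemma M_stable: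
  assumes "y \<in> M" "k \<in> K" shows "k y \<in> M"
  unfolding M_def
proof (intro CollectI ballI)
  fix g h assume gh: "g \<in> K" "h \<in> K"
  have "g (h (k y)) = k (g (h y))"
    using M_commute[OF assms(1) K_comp[OF gh] assms(2)] by simp
  moreover have "h (g (k y)) = k (h (g y))"
    using M_commute[OF assms(1) K_comp[OF gh(2,1)] assms(2)] by simp
  ultimately show "g (h (k y)) = h (g (k y))" using M_commute[OF assms(1) gh] by simp
qed

lemma finite_orbit: "finite ((\<lambda>g. g x) ` K)"
  by (rule finite_subset[OF _ finite_orbit_Gal[OF i alg]]) (use K_Gal in blast)

lemma finite_representatives:
  obtains T where "finite T" "T \<subseteq> K" "\<And>g. g \<in> K \<Longrightarrow> \<exists>t\<in>T. g x = t x"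
proof -
  obtain T where "T \<subseteq> K" "finite T" "(\<lambda>g. g x) ` K = (\<lambda>g. g x) ` T"
    using finite_subset_image[OF finite_orbit order_refl] by blast
  then show ?thesis using that[of T] by (metis (no_types, lifting) imageE imageI)
qed

lemma periodic:
  assumes g: "g \<in> K" shows "\<exists>n>0. (g ^^ n) x = x"
proof -
  have "range (\<lambda>n. (g ^^ n) x) \<subseteq> (\<lambda>g. g x) ` K" using K_funpow[OF g] by blast
  then have "finite (range (\<lambda>n. (g ^^ n) x))" using finite_orbit finite_subset by blast
  then have "\<not> inj (\<lambda>n. (g ^^ n) x)" using finite_imageD infinite_UNIV_nat by blast
  then obtain m n :: nat where mn: "(g ^^ m) x = (g ^^ n) x" "m < n"
    unfolding inj_def by (metis linorder_neqE_nat)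
  have "(g ^^ m) ((g ^^ (n - m)) x) = (g ^^ m) x"
    using mn funpow_add[of m "n - m" g] by simp
  then have "(g ^^ (n - m)) x = x" using K_inj[OF K_funpow[OF g]] by blast
  then show ?thesis using mn(2) by (intro exI[of _ "n - m"]) simp
qed

lemma funpow_fix: "(h ^^ n) x = x \<Longrightarrow> (h ^^ (n * k)) x = x"
  by (induction k) (simp_all add: funpow_add)

text \<open>A common period exists because \<open>K\<close> acts on the finite orbit of \<open>x\<close> through finitely many
  maps.\<close>
lemma M_periodic:
  assumes x: "x \<in> M" shows "\<exists>n>0. \<forall>g\<in>K. (g ^^ n) x = x"
proof -
  obtain T where T: "finite T" "T \<subseteq> K" "\<And>g. g \<in> K \<Longrightarrow> \<exists>t\<in>T. g x = t x"
    using finite_representatives by blast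
  have "\<forall>t\<in>T. \<exists>n>0. (t ^^ n) x = x" using periodic T(2) by blast
  then obtain f where f: "\<And>t. t \<in> T \<Longrightarrow> f t > 0 \<and> (t ^^ f t) x = x" by metis
  define n where "n = prod f T"
  have "(g ^^ n) x = x" if g: "g \<in> K" for g
  proof -
    obtain t where t: "t \<in> T" "g x = t x" using T(3)[OF g] by blast
    have "t \<in> K" using t T by blast
    have "(g ^^ j) x = (t ^^ j) x" for j
    proof (induction j)
      case (Suc j)
      have "(g ^^ Suc j) x = g ((t ^^ j) x)" using Suc by simp
      also have "\<dots> = (t ^^ j) (t x)" using M_commute[OF x g K_funpow[OF \<open>t \<in> K\<close>]] t(2) by simp
      finally show ?case by (simp add: funpow_swap1)
    qed simp
    moreover have "n = f t * prod f (T - {t})" using T(1) t(1) by (simp add: n_def prod.remove)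
    ultimately show ?thesis using funpow_fix[of "f t" t x] f[OF t(1)] by simp
  qed
  moreover have "n > 0" unfolding n_def using f by (intro prod_pos) blast
  ultimately show ?thesis by blast
qed

text \<open>Kummer theory. If \<open>c\<close> moved \<open>x\<close>, the space \<open>V\<close> of vectors that are killed by
  \<open>1 + c + \<dots> + c^(l-1)\<close> and lie in the field generated by \<open>x\<close> over the fixed field of \<open>K\<close> would
  contain \<open>c x - x\<close>. Here \<open>c\<close> has no nonzero fixed vector, since \<open>l\<close> is invertible. The
  elements of \<open>K\<close> multiply a joint eigenvector \<open>w\<close> in \<open>V\<close>, and hence also an \<open>l\<close>-th root \<open>b\<close> of \<open>w\<close>,
  by roots of unity. As these lie in \<open>F\<close>, the group \<open>K\<close> acts on \<open>b\<close> through an abelian group, so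
  \<open>c^l\<close> fixes \<open>b\<close>. Then the eigenvalue of \<open>c\<close> at \<open>b\<close> is an \<open>l\<close>-th root of unity, its \<open>l\<close>-th power \<open>1\<close>
  is the eigenvalue at \<open>w\<close>, and \<open>c\<close> fixes \<open>w\<close>, a contradiction.\<close>
lemma trivial_on_M_prime_to_char:
  assumes l: "l > 0" "of_nat l \<noteq> (0::'k)"
    and c: "c \<in> K" "\<And>y. y \<in> M \<Longrightarrow> (c ^^ l) y = y" and x: "x \<in> M"
  shows "c x = x"
proof (rule ccontr)
  assume cx: "c x \<noteq> x"
  \<comment> \<open>Since \<open>x\<close> lies in \<open>M\<close>, an element of \<open>K\<close> that fixes \<open>x\<close> also fixes its conjugates. Hence \<open>W\<close>
    contains the orbit of \<open>x\<close>, and \<open>K\<close> acts on \<open>W\<close> through a finite group.\<close>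
  define W where "W = {y \<in> M. \<forall>g\<in>K. g x = x \<longrightarrow> g y = y}"
  define V where "V = {v \<in> W. (\<Sum>j<l. (c ^^ j) v) = 0}"
  have W_stable: "g y \<in> W" if gK: "g \<in> K" and yW: "y \<in> W" for g y
  proof -
    have "y \<in> M \<and> (\<forall>h\<in>K. h x = x \<longrightarrow> h y = y)"
      by (rule CollectD[OF yW[unfolded W_def]])
    note y = conjunct1[OF this] conjunct2[OF this]
    have "h (g y) = g y" if h: "h \<in> K" "h x = x" for h
    proof -
      have "h (g y) = g (h y)" by (rule M_commute[OF y(1) h(1) gK])
      also have "h y = y" by (rule mp[OF bspec[OF y(2) h(1)] h(2)])
      finally show ?thesis .
    qed
    then show ?thesis using M_stable[OF y(1) gK] by (simp add: W_def)
  qed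
  have x0: "c x - x \<in> V"
  proof -
    have "x \<in> W" using x by (simp add: W_def)
    then have "c x + i (- 1) * x \<in> W"
      using W_stable[OF c(1)] by (auto simp: W_def K_simps intro!: M_add M_scale)
    moreover have "(\<Sum>j<l. (c ^^ j) (c x - x)) = (\<Sum>j<l. (c ^^ Suc j) x - (c ^^ j) x)"
      by (simp add: ring_map_diff[OF ring_map_funpow[OF K_ring_map[OF c(1)]]] funpow_swap1)
    moreover have "\<dots> = 0" using sum_lessThan_telescope[of "\<lambda>j. (c ^^ j) x" l] c(2)[OF x] by simp
    ultimately show ?thesis by (simp add: V_def ring_map_simps ri)
  qed
  obtain T where T: "finite T" "T \<subseteq> K" "\<And>g. g \<in> K \<Longrightarrow> \<exists>t\<in>T. g x = t x"
    using finite_representatives by blast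
  have "\<exists>w\<in>V. w \<noteq> 0 \<and> (\<forall>g\<in>T. \<exists>a. g w = i a * w)"
  proof (rule joint_eigenvector[OF ru ri _ _ T(1,2)])
    show "ring_map g" "g (i a) = i a" if "g \<in> K" for g a using that K_ring_map K_fix by auto
    show "v + w \<in> V" if "v \<in> V" "w \<in> V" for v w
      using that M_add
      by (auto simp: V_def W_def K_simps sum.distrib ring_map_add[OF ring_map_funpow[OF K_ring_map[OF c(1)]]])
    show "i a * v \<in> V" if "v \<in> V" for a v
      using that M_scale
      by (auto simp: V_def W_def K_simps ring_map_mult[OF ring_map_funpow[OF K_ring_map[OF c(1)]]]
        K_fix[OF K_funpow[OF c(1)]] simp flip: sum_distrib_left)
    show "g v \<in> V" if "g \<in> K" "v \<in> V" for g v
    proof -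
      have "v \<in> M" using that by (simp add: V_def W_def)
      have "(\<Sum>j<l. (c ^^ j) (g v)) = g (\<Sum>j<l. (c ^^ j) v)"
        unfolding ring_map_sum[OF K_ring_map[OF that(1)]]
        by (rule sum.cong[OF refl M_commute[OF \<open>v \<in> M\<close> K_funpow[OF c(1)] that(1)]])
      then show ?thesis using that W_stable by (simp add: V_def K_simps)
    qed
    show "g (h v) = h (g v)" if "g \<in> K" "h \<in> K" "v \<in> V" for g h v
      by (rule M_commute[OF _ that(1,2)]) (use that(3) in \<open>simp add: V_def W_def\<close>)
    show "\<exists>n>0. (g ^^ n) v = v" if "g \<in> K" for g v using that by (rule periodic)
    show "c x - x \<in> V" "c x - x \<noteq> 0" using x0 cx by auto
  qed
  then obtain w where w: "w \<in> V" "w \<noteq> 0" "\<And>g. g \<in> T \<Longrightarrow> \<exists>a. g w = i a * w" by blast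
  have w_eigen: "\<exists>a. g w = i a * w" if g: "g \<in> K" for g
  proof -
    obtain t where t: "t \<in> T" "g x = t x" using T(3)[OF g] by blast
    then obtain h where h: "h \<in> K" "\<And>x. h (t x) = x" "\<And>x. t (h x) = x" using K_inv T(2) by blast
    have "(h \<circ> g) x = x" using t h by simp
    moreover have "\<forall>k\<in>K. k x = x \<longrightarrow> k w = w" using w(1) by (simp add: V_def W_def)
    ultimately have "(h \<circ> g) w = w" using K_comp[OF h(1) g] by blast
    then have "g w = t w" using h(3) by (metis comp_apply)
    then show ?thesis using w(3)[OF t(1)] by simp
  qed
  obtain b where b: "b ^ l = w" using nth_root_exists_if_separably_closed[OF sc l] by blast
  have b0: "b \<noteq> 0" using b w(2) l(1) by (auto simp: zero_power)
  have b_eigen: "\<exists>a. g b = i a * b" if g: "g \<in> K" for g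
  proof -
    obtain a where a: "g w = i a * w" using w_eigen[OF g] by blast
    obtain n where n: "n > 0" "(g ^^ n) w = w" using periodic[OF g] by blast
    have "(g ^^ j) w = i a ^ j * w" for j
      by (induction j) (simp_all add: a K_simps(4,7,9) g mult_ac)
    then have ian: "i a ^ n = 1" using n(2) w(2) by simp
    have "(g b / b) ^ l = g w / w"
      using b by (simp add: power_divide flip: ring_map_power[OF K_ring_map[OF g]])
    then have "(g b / b) ^ (l * n) = 1" using a ian w(2) by (simp add: power_mult)
    then have "g b / b \<in> range i"
      using root_of_unity_in_range[OF ru ri, of "l * n"] l(1) n(1) by simp
    then show ?thesis using b0 by (auto simp: field_simps)
  qed
  have "b \<in> M"
    unfolding M_def
  proof (intro CollectI ballI)
    fix g h assume gh: "g \<in> K" "h \<in> K"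
    obtain a d where "g b = i a * b" "h b = i d * b" using b_eigen gh by metis
    then show "g (h b) = h (g b)" using gh by (simp add: K_simps mult_ac)
  qed
  obtain a where a: "c b = i a * b" using b_eigen[OF c(1)] by blast
  have "(c ^^ j) b = i a ^ j * b" for j
    by (induction j) (simp_all add: a K_simps(4,7,9) c(1) mult_ac)
  then have "i a ^ l = 1" using c(2)[OF \<open>b \<in> M\<close>] b0 by simp
  then have "c w = w"
    using a b by (metis K_ring_map[OF c(1)] mult_1 power_mult_distrib ring_map_power)
  then have "(c ^^ j) w = w" for j by (induction j) simp_all
  then have "(\<Sum>j<l. (c ^^ j) w) = of_nat l * w" by simp
  then show False using w(1,2) l(2) by (simp add: V_def)
qed

text \<open>The fixed field of \<open>B\<close> is a cyclic extension of degree \<open>p^m\<close> of the fixed field of \<open>K\<close>,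
  with generator \<open>s\<close> of its Galois group, and it is moved by \<open>c\<close>. It comes from a cyclic
  quotient of the group through which \<open>K\<close> acts on the orbit of \<open>x\<close>.\<close>
lemma cyclic_extension_moved:
  assumes p: "Factorial_Ring.prime (p::nat)"
    and c: "c \<in> K" "\<And>y. y \<in> M \<Longrightarrow> (c ^^ p) y = y" and x: "x \<in> M" "c x \<noteq> x"
  obtains B s m where "B \<subseteq> K" "s \<in> K" "m > 0" "c \<notin> B"
    "\<forall>t\<in>K. (\<forall>y. (\<forall>b\<in>B. b y = y) \<longrightarrow> t y = y) \<longrightarrow> t \<in> B"
    "\<forall>j. s ^^ j \<in> B \<longleftrightarrow> p ^ m dvd j"
    "\<forall>t\<in>K. \<exists>j. \<exists>b\<in>B. t = b \<circ> s ^^ j"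
    "\<forall>y. (\<forall>b\<in>B. b y = y) \<longrightarrow> y \<in> M"
proof -
  define G where "G = (Gal i)\<lparr>carrier := K\<rparr>"
  interpret Gal: group "Gal i" by (rule group_Gal)
  have "group G" unfolding G_def by (rule Gal.subgroup_imp_group[OF K])
  then interpret G: group G .
  have G_simps: "carrier G = K" "g \<otimes>\<^bsub>G\<^esub> h = g \<circ> h" "\<one>\<^bsub>G\<^esub> = id" for g h
    by (simp_all add: G_def Gal_def)
  have G_pow: "g [^]\<^bsub>G\<^esub> n = g ^^ n" for g and n :: nat
    unfolding G_def Gal.nat_pow_consistent[symmetric] by (rule Gal_pow)
  have G_inv: "m_inv G g (g y) = y" "g (m_inv G g y) = y" "m_inv G g \<in> K" if "g \<in> K" for g y
    using G.l_inv[of g] G.r_inv[of g] G.inv_closed[of g] that by (auto simp: G_simps fun_eq_iff)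
  define H where "H = {g \<in> K. g x = x}"
  have H: "subgroup H G"
  proof (rule G.subgroupI)
    show "H \<subseteq> carrier G" by (auto simp: H_def G_simps)
    show "H \<noteq> {}" using K_id by (auto simp: H_def)
    show "inv\<^bsub>G\<^esub> a \<in> H" if "a \<in> H" for a
      using that G_inv(1)[of a x] G_inv(3)[of a] by (auto simp: H_def)
    show "a \<otimes>\<^bsub>G\<^esub> b \<in> H" if "a \<in> H" "b \<in> H" for a b
      using that K_comp[of a b] by (simp add: H_def G_simps)
  qed
  have fix_comm: "a \<otimes>\<^bsub>G\<^esub> b \<otimes>\<^bsub>G\<^esub> inv\<^bsub>G\<^esub> a \<otimes>\<^bsub>G\<^esub> inv\<^bsub>G\<^esub> b \<in> H"
    if "a \<in> carrier G" "b \<in> carrier G" for a b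
  proof -
    have ab: "a \<in> K" "b \<in> K" using that by (simp_all add: G_simps)
    have "a (b (m_inv G a (m_inv G b x))) = a (b (m_inv G b (m_inv G a x)))"
      using M_commute[OF x(1) G_inv(3)[OF ab(1)] G_inv(3)[OF ab(2)]] by simp
    also have "\<dots> = x" by (simp only: G_inv(2)[OF ab(1)] G_inv(2)[OF ab(2)])
    finally have "(a \<circ> b \<circ> m_inv G a \<circ> m_inv G b) x = x" by simp
    moreover have "a \<circ> b \<circ> m_inv G a \<circ> m_inv G b \<in> K"
      by (intro K_comp G_inv(3) ab)
    ultimately show ?thesis by (simp add: H_def G_simps)
  qed
  obtain n where n: "n > 0" "\<forall>g\<in>K. (g ^^ n) x = x" using M_periodic[OF x(1)] by blast
  have "\<exists>B s m. subgroup B G \<and> H \<subseteq> B \<and> c \<notin> B \<and> s \<in> carrier G \<and> m > 0 \<and>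
    (\<forall>j. s [^]\<^bsub>G\<^esub> (j::nat) \<in> B \<longleftrightarrow> p ^ m dvd j) \<and>
    (\<forall>t\<in>carrier G. \<exists>j::nat. \<exists>b\<in>B. t = b \<otimes>\<^bsub>G\<^esub> s [^]\<^bsub>G\<^esub> j)"
  proof (rule G.cyclic_quotient_detecting_prime_order[OF H fix_comm n(1) _ p])
    show "t [^]\<^bsub>G\<^esub> n \<in> H" if "t \<in> carrier G" for t
      using that n(2) K_funpow by (auto simp: H_def G_simps G_pow)
    show "c \<in> carrier G" "c \<notin> H" "c [^]\<^bsub>G\<^esub> p \<in> H"
      using c(1) c(2)[OF x(1)] x(2) K_funpow by (auto simp: H_def G_simps G_pow)
  qed
  then obtain B s m where B: "subgroup B G" "H \<subseteq> B" "c \<notin> B" "s \<in> K" "m > 0"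
      "\<And>j. s ^^ j \<in> B \<longleftrightarrow> p ^ m dvd j" "\<And>t. t \<in> K \<Longrightarrow> \<exists>j. \<exists>b\<in>B. t = b \<circ> s ^^ j"
    unfolding G_simps G_pow by blast
  have BK: "B \<subseteq> K" using subgroup.subset[OF B(1)] by (simp add: G_simps)
  have B_comp: "a \<circ> b \<in> B" if "a \<in> B" "b \<in> B" for a b
    using subgroup.m_closed[OF B(1) that] by (simp add: G_simps)
  have B_inv: "m_inv G a \<in> B" if "a \<in> B" for a
    using subgroup.m_inv_closed[OF B(1) that] .
  \<comment> \<open>Galois correspondence for \<open>B\<close>: as \<open>B\<close> contains the stabilizer of \<open>x\<close>, it suffices to compare the
    effects on \<open>x\<close>.\<close>
  have sep: "t \<in> B" if t: "t \<in> K" and fixes_t: "\<forall>y. (\<forall>b\<in>B. b y = y) \<longrightarrow> t y = y" for t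
  proof -
    define S where "S = (\<lambda>b. b x) ` B"
    have "t x \<in> S"
    proof (rule image_in_finite_orbit[where s = t and u = x and S = S and D = B])
      show "finite S" unfolding S_def using BK finite_orbit by (rule finite_subset[OF image_mono])
      have "id \<in> B" using subgroup.one_closed[OF B(1)] by (simp add: G_simps)
      then have "id x \<in> S" unfolding S_def by (rule imageI)
      then show "x \<in> S" by simp
      show "ring_map t" using t by (rule K_ring_map)
      show "t y = y" if "\<And>b. b \<in> B \<Longrightarrow> b y = y" for y using fixes_t that by blast
      show "ring_map b \<and> inj_on b S \<and> b ` S = S" if b: "b \<in> B" for b
      proof (intro conjI)
        have bK: "b \<in> K" using b BK by blast
        show "ring_map b" using bK by (rule K_ring_map)
        show "inj_on b S" using K_inj[OF bK] by (simp add: inj_on_def)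
        show "b ` S = S"
        proof (intro subset_antisym subsetI)
          fix y assume "y \<in> b ` S"
          then obtain a where a: "a \<in> B" "y = (b \<circ> a) x" by (auto simp: S_def)
          then show "y \<in> S" using B_comp[OF b a(1)] unfolding S_def by blast
        next
          fix y assume "y \<in> S"
          then obtain a where a: "a \<in> B" "y = a x" by (auto simp: S_def)
          have "y = b ((m_inv G b \<circ> a) x)" using a(2) G_inv(2)[OF bK] by simp
          then show "y \<in> b ` S" using B_comp[OF B_inv[OF b] a(1)] unfolding S_def by blast
        qed
      qed
    qed
    then obtain b where b: "b \<in> B" "t x = b x" by (auto simp: S_def)
    have bK: "b \<in> K" using b BK by blast
    have "(m_inv G b \<circ> t) x = x" using b(2) G_inv(1)[OF bK] by simp
    then have "m_inv G b \<circ> t \<in> H" using K_comp[OF G_inv(3)[OF bK] t] by (simp add: H_def)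
    then have "b \<circ> (m_inv G b \<circ> t) \<in> B" using B(2) b(1) B_comp by blast
    moreover have "b \<circ> (m_inv G b \<circ> t) = t" by (simp add: fun_eq_iff G_inv(2)[OF bK])
    ultimately show ?thesis by simp
  qed
  have fixM: "y \<in> M" if y: "\<And>b. b \<in> B \<Longrightarrow> b y = y" for y
    unfolding M_def
  proof (intro CollectI ballI)
    fix g h assume gh: "g \<in> K" "h \<in> K"
    have "m_inv G g \<otimes>\<^bsub>G\<^esub> m_inv G h \<otimes>\<^bsub>G\<^esub> inv\<^bsub>G\<^esub> (m_inv G g) \<otimes>\<^bsub>G\<^esub> inv\<^bsub>G\<^esub> (m_inv G h) \<in> H"
      using gh by (intro fix_comm) (simp_all add: G_simps G_inv)
    then have "m_inv G g \<circ> m_inv G h \<circ> g \<circ> h \<in> B"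
      using gh B(2) G.inv_inv by (auto simp: G_simps)
    then have "m_inv G g (m_inv G h (g (h y))) = y" using y by fastforce
    then have "h (g (m_inv G g (m_inv G h (g (h y))))) = h (g y)" by simp
    then show "g (h y) = h (g y)" by (simp only: G_inv(2)[OF gh(1)] G_inv(2)[OF gh(2)])
  qed
  show ?thesis
    by (rule that[OF BK B(4,5,3)]) (use sep B(6,7) fixM in blast)+
qed

text \<open>In characteristic \<open>p\<close> every cyclic extension \<open>E\<close> of degree \<open>n = p^m\<close> with generator \<open>s\<close>
  embeds into a cyclic extension of degree \<open>p n\<close> (Albert). If \<open>\<beta>\<close> has trace \<open>1\<close>, then
  \<open>\<gamma> = \<beta>^p - \<beta>\<close> has trace \<open>0\<close>, so by the additive form of Hilbert's Theorem 90 it equals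
  \<open>s \<alpha> - \<alpha>\<close> for some \<open>\<alpha>\<close> in \<open>E\<close>. A root \<open>\<theta>\<close> of \<open>X^p - X - \<alpha>\<close> satisfies \<open>s \<theta> = \<theta> + \<beta> + d0\<close> with
  \<open>d0^p = d0\<close>, whence \<open>s^n \<theta> = \<theta> + 1\<close>. On \<open>E(\<theta>)\<close> each element of \<open>K\<close> agrees with a power of \<open>s\<close>
  up to a translation of \<open>\<theta>\<close> by a root of \<open>X^p - X\<close>, so \<open>\<theta>\<close> lies in \<open>M\<close>. If \<open>c\<close> acts on \<open>E\<close> as
  \<open>s^j\<close>, then \<open>c^p\<close> acts as \<open>s^(j p)\<close> on all of \<open>E(\<theta>)\<close>. This action is trivial, so \<open>j p\<close> is
  divisible by \<open>p n\<close>, and \<open>c\<close> is trivial on \<open>E\<close>, whereas \<open>E\<close> was chosen to be moved by \<open>c\<close>.\<close>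
lemma trivial_on_M_char:
  assumes p: "Factorial_Ring.prime p" "of_nat p = (0::'k)"
    and c: "c \<in> K" "\<And>y. y \<in> M \<Longrightarrow> (c ^^ p) y = y" and x: "x \<in> M"
  shows "c x = x"
proof (rule ccontr)
  assume cx: "c x \<noteq> x"
  obtain B s m where B: "B \<subseteq> K" and s: "s \<in> K" and m: "m > 0" and cB: "c \<notin> B"
    and sep: "\<forall>t\<in>K. (\<forall>y. (\<forall>b\<in>B. b y = y) \<longrightarrow> t y = y) \<longrightarrow> t \<in> B"
    and sB: "\<forall>j. s ^^ j \<in> B \<longleftrightarrow> p ^ m dvd j"
    and gen: "\<forall>t\<in>K. \<exists>j. \<exists>b\<in>B. t = b \<circ> s ^^ j"
    and fixM: "\<forall>y. (\<forall>b\<in>B. b y = y) \<longrightarrow> y \<in> M"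
    by (rule cyclic_extension_moved[OF p(1) c x cx])
  define E where "E = {y. \<forall>b\<in>B. b y = y}"
  have fixE: "b y = y" if "y \<in> E" "b \<in> B" for b y
    using that unfolding E_def by blast
  define n where "n = p ^ m"
  have p1: "p > 1" using p(1) by (rule prime_gt_1_nat)
  have n1: "n > 1" unfolding n_def using one_less_power[OF p1 m] .
  have n0: "of_nat n = (0::'k)" unfolding n_def using p(2) m by (simp add: zero_power)
  have CHAR: "CHAR('k) = p"
  proof -
    have "CHAR('k) dvd p" using p(2) of_nat_eq_0_iff_char_dvd by blast
    moreover have "CHAR('k) \<noteq> 1" by simp
    ultimately show ?thesis using p(1) by (metis prime_nat_iff)
  qed
  have frob: "(a + b) ^ p = a ^ p + b ^ p" for a b :: 'k
    using p(1) CHAR by (intro freshmans_dream) auto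
  have frob_diff: "(a - b) ^ p = a ^ p - b ^ p" for a b :: 'k
    using frob[of "a - b" b] by (simp add: algebra_simps)
  have frob_sum: "sum f A ^ p = (\<Sum>a\<in>A. f a ^ p)" for f :: "nat \<Rightarrow> 'k" and A
    using p(1) CHAR by (intro freshmans_dream_sum) auto
  have AS_kernel: "d \<in> range i" if d: "d ^ p = d" for d
  proof (cases "d = 0")
    case True
    then show ?thesis using ring_map_0[OF ri] by (metis rangeI)
  next
    case False
    have "d * d ^ (p - 1) = d * 1" using d p1 by (simp flip: power_Suc)
    then have "d ^ (p - 1) = 1" using False by (metis mult_left_cancel)
    then show ?thesis using root_of_unity_in_range[OF ru ri, of "p - 1" d] p1 by simp
  qed
  have K_AS: "g d = d" if "g \<in> K" "d ^ p = d" for g d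
    using AS_kernel[OF that(2)] K_fix[OF that(1)] by auto
  note sj = K_funpow[OF s]
  have s_add: "(s ^^ j) (y + z) = (s ^^ j) y + (s ^^ j) z" for j y z
    by (rule ring_map_add[OF K_ring_map[OF sj]])
  have EM: "E \<subseteq> M" using fixM unfolding E_def by blast
  have E_add: "y + z \<in> E" and E_mult: "y * z \<in> E" and E_uminus: "- y \<in> E"
    and E_pow: "y ^ k \<in> E" if "y \<in> E" "z \<in> E" for y z k
    using that B by (auto simp: E_def K_simps subset_iff)
  have E_inv: "inverse y \<in> E" if y: "y \<in> E" for y
    unfolding E_def
  proof (intro CollectI ballI)
    fix b assume b: "b \<in> B"
    have "b (inverse y) = inverse (b y)" by (rule ring_map_inverse[OF K_ring_map[OF subsetD[OF B b]]])
    then show "b (inverse y) = inverse y" by (simp only: fixE[OF y b])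
  qed
  have E1: "1 \<in> E" and E0: "0 \<in> E" using B by (auto simp: E_def K_simps subset_iff)
  have E_sum: "sum f A \<in> E" if "\<And>a. a \<in> A \<Longrightarrow> f a \<in> E" for f :: "nat \<Rightarrow> 'k" and A
    using that by (induction A rule: infinite_finite_induct) (auto intro: E0 E_add)
  have E_stable: "g y \<in> E" if g: "g \<in> K" and y: "y \<in> E" for g y
    unfolding E_def
  proof (intro CollectI ballI)
    fix b assume b: "b \<in> B"
    have "b (g y) = g (b y)" using M_commute EM y b B g by blast
    then show "b (g y) = g y" by (simp only: fixE[OF y b])
  qed
  have gen_E: "\<exists>j. \<forall>y\<in>E. t y = (s ^^ j) y" if t: "t \<in> K" for t
  proof -
    obtain j b where b: "b \<in> B" "t = b \<circ> s ^^ j" using bspec[OF gen t] by blast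
    have "t y = (s ^^ j) y" if "y \<in> E" for y
      unfolding b(2) comp_apply by (rule fixE[OF E_stable[OF sj that] b(1)])
    then show ?thesis by blast
  qed
  have triv_E: "(\<forall>y\<in>E. (s ^^ j) y = y) \<longleftrightarrow> n dvd j" for j
  proof
    show "n dvd j" if "\<forall>y\<in>E. (s ^^ j) y = y"
      using bspec[OF sep sj] sB that unfolding E_def n_def by blast
    show "\<forall>y\<in>E. (s ^^ j) y = y" if "n dvd j"
      using sB that unfolding E_def n_def by blast
  qed
  have sn: "(s ^^ n) y = y" if "y \<in> E" for y using triv_E[of n] that by simp
  \<comment> \<open>By Dedekind's theorem the trace does not vanish on \<open>E\<close>, which yields \<open>\<beta>\<close> of trace \<open>1\<close>.\<close>
  define Tr where "Tr y = (\<Sum>j<n. (s ^^ j) y)" for y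
  have "\<exists>u\<in>E. Tr u \<noteq> 0"
  proof (rule ccontr)
    assume *: "\<not> (\<exists>u\<in>E. Tr u \<noteq> 0)"
    have "\<forall>j\<in>{..<n}. (1::'k) = 0"
    proof (rule dedekind_independence[of _ E "\<lambda>j. s ^^ j" "\<lambda>_. 1"])
      show "(\<Sum>j<n. 1 * (s ^^ j) y) = 0" if "y \<in> E" for y using * that by (simp add: Tr_def)
      show "\<exists>y\<in>E. (s ^^ j) y \<noteq> (s ^^ k) y" if "j \<in> {..<n}" "k \<in> {..<n}" "j \<noteq> k" for j k
        using that
      proof (induction j k rule: linorder_wlog)
        case (le j k)
        show ?case
        proof (rule ccontr)
          assume "\<not> (\<exists>y\<in>E. (s ^^ j) y \<noteq> (s ^^ k) y)"
          then have "(s ^^ j) ((s ^^ (k - j)) y) = (s ^^ j) y" if "y \<in> E" for y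
            using that le(1) funpow_add[of j "k - j" s] by simp
          then have "\<forall>y\<in>E. (s ^^ (k - j)) y = y" using K_inj[OF sj] by blast
          then have "n dvd k - j" using triv_E by blast
          then show False using le by (auto dest: dvd_imp_le)
        qed
      next
        case (sym j k)
        then show ?case by metis
      qed
    qed (use E1 E_mult K_ring_map[OF sj] in \<open>auto simp: ring_map_1 ring_map_mult\<close>)
    then show False using n1 by auto
  qed
  then obtain u where u: "u \<in> E" "Tr u \<noteq> 0" by blast
  have shift: "(\<Sum>j<n. f (Suc j)) = (\<Sum>j<n. f j) + f n - f 0" for f :: "nat \<Rightarrow> 'k"
    using sum.lessThan_Suc_shift[of f n] by (simp add: algebra_simps)
  have s_Tr: "s (Tr u) = Tr u"
    using shift[of "\<lambda>j. (s ^^ j) u"] sn[OF u(1)]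
    by (simp add: Tr_def ring_map_sum[OF K_ring_map[OF s]])
  then have sj_Tr: "(s ^^ j) (Tr u) = Tr u" for j by (induction j) simp_all
  define \<beta> where "\<beta> = u * inverse (Tr u)"
  have Tr_E: "Tr u \<in> E" unfolding Tr_def by (rule E_sum) (use E_stable[OF sj u(1)] in auto)
  have \<beta>: "\<beta> \<in> E" unfolding \<beta>_def using E_mult E_inv u(1) Tr_E by blast
  have "(\<Sum>j<n. (s ^^ j) \<beta>) = (\<Sum>j<n. (s ^^ j) u * inverse (Tr u))"
    by (simp add: \<beta>_def ring_map_mult[OF K_ring_map[OF sj]] ring_map_inverse[OF K_ring_map[OF sj]] sj_Tr)
  also have "\<dots> = Tr u * inverse (Tr u)" by (simp add: Tr_def sum_distrib_right)
  finally have Tr_\<beta>: "(\<Sum>j<n. (s ^^ j) \<beta>) = 1" using u(2) by simp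
  \<comment> \<open>The usual explicit solution of \<open>s \<alpha> - \<alpha> = \<gamma>\<close> in terms of the partial traces of \<open>\<gamma>\<close> and an element of
    trace \<open>1\<close>.\<close>
  define \<gamma> where "\<gamma> = \<beta> ^ p - \<beta>"
  define S where "S j = (\<Sum>l<j. (s ^^ l) \<gamma>)" for j
  have \<gamma>: "\<gamma> \<in> E" unfolding \<gamma>_def using E_add[OF E_pow[OF \<beta> \<beta>] E_uminus[OF \<beta> \<beta>]] by simp
  have "S n = (\<Sum>l<n. (s ^^ l) \<beta>) ^ p - (\<Sum>l<n. (s ^^ l) \<beta>)"
    unfolding S_def frob_sum sum_subtractf[symmetric]
    by (rule sum.cong) (simp_all add: \<gamma>_def ring_map_simps K_ring_map[OF sj])
  then have S_n: "S n = 0" by (simp add: Tr_\<beta>)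
  have s_S: "s (S j) = S (Suc j) - \<gamma>" for j
    unfolding S_def sum.lessThan_Suc_shift by (simp add: ring_map_sum[OF K_ring_map[OF s]])
  define \<alpha> where "\<alpha> = - (\<Sum>j<n. S j * (s ^^ j) \<beta>)"
  have S_E: "S j \<in> E" for j unfolding S_def by (rule E_sum) (rule E_stable[OF sj \<gamma>])
  have \<alpha>: "\<alpha> \<in> E"
    unfolding \<alpha>_def by (rule E_uminus[OF E_sum E0]) (rule E_mult[OF S_E E_stable[OF sj \<beta>]])
  have "s \<alpha> = - (\<Sum>j<n. (S (Suc j) - \<gamma>) * (s ^^ Suc j) \<beta>)"
    by (simp add: \<alpha>_def ring_map_sum[OF K_ring_map[OF s]] K_simps s s_S)
  also have "\<dots> = - (\<Sum>j<n. S (Suc j) * (s ^^ Suc j) \<beta>) + \<gamma> * (\<Sum>j<n. (s ^^ Suc j) \<beta>)"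
    by (simp add: left_diff_distrib sum_subtractf sum_distrib_left)
  also have "(\<Sum>j<n. (s ^^ Suc j) \<beta>) = 1"
    using shift[of "\<lambda>j. (s ^^ j) \<beta>"] sn[OF \<beta>] Tr_\<beta> by simp
  also have "(\<Sum>j<n. S (Suc j) * (s ^^ Suc j) \<beta>) = - \<alpha>"
    using shift[of "\<lambda>j. S j * (s ^^ j) \<beta>"] S_n by (simp add: \<alpha>_def S_def)
  finally have s_\<alpha>: "s \<alpha> = \<alpha> + \<gamma>" by simp
  obtain \<theta> where \<theta>: "\<theta> ^ p - \<theta> = \<alpha>" using artin_schreier_root_exists[OF sc p1 p(2)] by blast
  have g_\<theta>: "(g \<theta>) ^ p - g \<theta> = g \<alpha>" if "g \<in> K" for g
    unfolding \<theta>[symmetric] using that by (simp add: K_simps)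
  define d0 where "d0 = s \<theta> - \<theta> - \<beta>"
  have d0: "d0 ^ p = d0"
  proof -
    have "d0 ^ p = (s \<theta>) ^ p - \<theta> ^ p - \<beta> ^ p" by (simp only: d0_def frob_diff)
    also have "\<dots> = (s \<alpha> + s \<theta>) - (\<alpha> + \<theta>) - (\<gamma> + \<beta>)"
      unfolding g_\<theta>[OF s, symmetric] \<gamma>_def by (simp add: \<theta>[symmetric])
    also have "\<dots> = d0" by (simp add: s_\<alpha> d0_def)
    finally show ?thesis .
  qed
  have sj_\<theta>: "(s ^^ j) \<theta> = \<theta> + (\<Sum>l<j. (s ^^ l) \<beta>) + of_nat j * d0" for j
  proof (induction j)
    case (Suc j)
    have "(s ^^ Suc j) \<theta> = (s ^^ j) (s \<theta>)" by (simp add: funpow_swap1)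
    also have "s \<theta> = \<theta> + \<beta> + d0" by (simp add: d0_def)
    also have "(s ^^ j) (\<theta> + \<beta> + d0) = (s ^^ j) \<theta> + (s ^^ j) \<beta> + d0"
      using K_AS[OF sj d0] by (simp add: s_add)
    finally show ?case using Suc by (simp add: algebra_simps)
  qed simp
  have sj_\<theta>_E: "\<exists>e\<in>E. \<exists>d. d ^ p = d \<and> (s ^^ j) \<theta> = \<theta> + e + d" for j
  proof -
    have "(of_nat j * d0) ^ p = of_nat j * d0"
    proof (induction j)
      case 0
      then show ?case using p1 by (simp add: zero_power)
    next
      case (Suc j)
      then show ?case using d0 by (simp add: distrib_right frob)
    qed
    moreover have "(\<Sum>l<j. (s ^^ l) \<beta>) \<in> E" by (rule E_sum) (rule E_stable[OF sj \<beta>])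
    ultimately show ?thesis using sj_\<theta> by blast
  qed
  have sn_\<theta>: "(s ^^ n) \<theta> = \<theta> + 1" using sj_\<theta>[of n] Tr_\<beta> n0 by simp
  have snk_\<theta>: "(s ^^ (n * k)) \<theta> = \<theta> + of_nat k" for k
  proof (induction k)
    case (Suc k)
    have "(s ^^ (n * Suc k)) \<theta> = (s ^^ n) ((s ^^ (n * k)) \<theta>)" by (simp add: funpow_add)
    then show ?case using Suc sn_\<theta> by (simp add: s_add ring_map_of_nat[OF K_ring_map[OF sj]])
  qed simp
  have act: "\<exists>j d. d ^ p = d \<and> (\<forall>y\<in>E. g y = (s ^^ j) y) \<and> g \<theta> = (s ^^ j) \<theta> + d" if g: "g \<in> K" for g
  proof -
    obtain j where j: "\<forall>y\<in>E. g y = (s ^^ j) y" using gen_E[OF g] by blast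
    define d where "d = g \<theta> - (s ^^ j) \<theta>"
    have "d ^ p = d"
    proof -
      have "g \<alpha> = (s ^^ j) \<alpha>" using j \<alpha> by blast
      then have "(g \<theta>) ^ p - g \<theta> = ((s ^^ j) \<theta>) ^ p - (s ^^ j) \<theta>"
        by (simp only: g_\<theta>[OF g] g_\<theta>[OF sj])
      then show ?thesis unfolding d_def frob_diff by (simp add: algebra_simps)
    qed
    then show ?thesis using j by (intro exI[of _ j] exI[of _ d]) (simp add: d_def)
  qed
  have act_sk: "g ((s ^^ k) \<theta>) = (s ^^ (j + k)) \<theta> + d"
    if g: "g \<in> K" and d: "d ^ p = d" and j: "\<forall>y\<in>E. g y = (s ^^ j) y" "g \<theta> = (s ^^ j) \<theta> + d" for g j d k
  proof -
    obtain e d' where e: "e \<in> E" "d' ^ p = d'" "(s ^^ k) \<theta> = \<theta> + e + d'" using sj_\<theta>_E by blast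
    have "g ((s ^^ k) \<theta>) = (s ^^ j) \<theta> + (s ^^ j) e + d' + d"
      using e K_AS[OF g e(2)] j by (simp add: ring_map_add[OF K_ring_map[OF g]])
    also have "\<dots> = (s ^^ j) ((s ^^ k) \<theta>) + d" using e(3) K_AS[OF sj e(2)] by (simp add: s_add)
    finally show ?thesis by (simp add: funpow_add)
  qed
  have "\<theta> \<in> M"
    unfolding M_def
  proof (intro CollectI ballI)
    fix g h assume g: "g \<in> K" and h: "h \<in> K"
    obtain j d where j: "d ^ p = d" "\<forall>y\<in>E. g y = (s ^^ j) y" "g \<theta> = (s ^^ j) \<theta> + d" using act[OF g] by blast
    obtain k d' where k: "d' ^ p = d'" "\<forall>y\<in>E. h y = (s ^^ k) y" "h \<theta> = (s ^^ k) \<theta> + d'" using act[OF h] by blast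
    have "g (h \<theta>) = (s ^^ (j + k)) \<theta> + d + d'"
      using act_sk[OF g j] K_AS[OF g k(1)] k(3) by (simp add: ring_map_add[OF K_ring_map[OF g]])
    moreover have "h (g \<theta>) = (s ^^ (k + j)) \<theta> + d' + d"
      using act_sk[OF h k] K_AS[OF h j(1)] j(3) by (simp add: ring_map_add[OF K_ring_map[OF h]])
    ultimately show "g (h \<theta>) = h (g \<theta>)" by (simp add: add_ac)
  qed
  obtain j d where j: "d ^ p = d" "\<forall>y\<in>E. c y = (s ^^ j) y" "c \<theta> = (s ^^ j) \<theta> + d" using act[OF c(1)] by blast
  have c_pow: "(c ^^ k) \<theta> = (s ^^ (j * k)) \<theta> + of_nat k * d" for k
  proof (induction k)
    case (Suc k)
    have "c (of_nat k * d) = of_nat k * d"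
      using K_AS[OF c(1) j(1)] by (simp add: K_simps c(1))
    then have "(c ^^ Suc k) \<theta> = c ((s ^^ (j * k)) \<theta>) + of_nat k * d"
      using Suc by (simp add: ring_map_add[OF K_ring_map[OF c(1)]])
    then show ?case using act_sk[OF c(1) j] by (simp add: algebra_simps)
  qed simp
  have c_pow_E: "(c ^^ k) y = (s ^^ (j * k)) y" if "y \<in> E" for k y
  proof (induction k)
    case (Suc k)
    then have "(c ^^ Suc k) y = (s ^^ j) ((s ^^ (j * k)) y)" using j(2) E_stable[OF sj that] by simp
    then show ?case by (simp add: funpow_add)
  qed simp
  have "n dvd j * p"
    unfolding triv_E[symmetric] using c(2) EM c_pow_E[of _ p] by (metis subsetD)
  then obtain e where e: "j * p = n * e" by blast
  have "(s ^^ (j * p)) \<theta> = \<theta>" using c_pow[of p] c(2)[OF \<open>\<theta> \<in> M\<close>] p(2) by simp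
  then have "of_nat e = (0::'k)" using snk_\<theta>[of e] e by simp
  then have "p dvd e" using of_nat_eq_0_iff_char_dvd[where 'a='k] CHAR by simp
  then have "n dvd j" using e p1 by (auto elim!: dvdE)
  then have "\<forall>y\<in>E. c y = y" using triv_E j(2) by simp
  then have "c \<in> B" using bspec[OF sep c(1)] unfolding E_def by blast
  then show False using cB by blast
qed

lemma trivial_on_M:
  assumes l: "Factorial_Ring.prime l"
    and c: "c \<in> K" "\<And>y. y \<in> M \<Longrightarrow> (c ^^ l) y = y" and x: "x \<in> M"
  shows "c x = x"
proof (cases "of_nat l = (0::'k)")
  case True
  then show ?thesis by (rule trivial_on_M_char[OF l _ c x])
next
  case False
  then show ?thesis by (rule trivial_on_M_prime_to_char[OF prime_gt_0_nat[OF l] _ c x])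
qed

end

section \<open>The abelianization of a closed subgroup\<close>

text \<open>The Galois correspondence: an element outside the closure of \<open>D\<close> moves the fixed field of
  \<open>D\<close>. The finite set is encoded as the coefficients of one polynomial \<open>u\<close>, on which the
  automorphisms act coefficientwise; this makes a primitive element unnecessary. If \<open>g\<close> fixed
  every element that \<open>D\<close> fixes, it would map \<open>u\<close> into the \<open>D\<close>-orbit of \<open>u\<close>.\<close>
lemma fixed_element_moved_if_no_agreement:
  fixes i :: "'f::field \<Rightarrow> 'k::field"
  assumes i: "field_embedding i" and alg: "\<And>x. separable_over i x"
    and D: "subgroup D (Gal i)" and g: "g \<in> carrier (Gal i)" and B: "finite B"
    and no: "\<not> (\<exists>d\<in>D. \<forall>b\<in>B. d b = g b)"
  shows "\<exists>y. (\<forall>d\<in>D. d y = y) \<and> g y \<noteq> y"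
proof (rule ccontr)
  assume "\<not> (\<exists>y. (\<forall>d\<in>D. d y = y) \<and> g y \<noteq> y)"
  then have fix_g: "g y = y" if "\<And>d. d \<in> D \<Longrightarrow> d y = y" for y using that by blast
  obtain bs where bs: "set bs = B" using finite_list[OF B] by blast
  define u where "u = Poly bs"
  define S where "S = (\<lambda>d. map_poly d u) ` D"
  have DG: "d \<in> carrier (Gal i)" if "d \<in> D" for d using D that by (rule subgroup.mem_carrier)
  have D_ring: "ring_map d" if "d \<in> D" for d using DG[OF that] by (simp add: mem_Gal_iff)
  have g_ring: "ring_map g" using g by (simp add: mem_Gal_iff)
  have coeff: "Polynomial.coeff (map_poly f u) j = f (bs ! j)" if "ring_map f" "j < length bs" for f j
    using that by (simp add: u_def coeff_map_poly_ring_map coeff_Poly_eq nth_default_def)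
  have map_comp: "map_poly d (map_poly e p) = map_poly (d \<circ> e) p" if "d \<in> D" "e \<in> D" for d e p
    using ring_map_0[OF D_ring[OF that(1)]] ring_map_0[OF D_ring[OF that(2)]] by (intro map_poly_map_poly) auto
  have map_Poly: "map_poly d u = Poly (map d bs)" if "d \<in> D" for d
  proof -
    have "d 0 = 0" using D_ring[OF that] by (rule ring_map_0)
    then show ?thesis
      by (simp add: u_def poly_eq_iff coeff_map_poly coeff_Poly_eq nth_default_def)
  qed
  have "map_poly g u \<in> S"
  proof (rule image_in_finite_orbit[where s = "map_poly g" and u = u and S = S and D = "map_poly ` D"])
    define Orb where "Orb = (\<Union>b\<in>B. (\<lambda>d. d b) ` carrier (Gal i))"
    have "finite Orb" unfolding Orb_def using B finite_orbit_Gal[OF i alg] by blast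
    then have "finite {xs. set xs \<subseteq> Orb \<and> length xs = length bs}" by (rule finite_lists_length_eq)
    moreover have "S \<subseteq> Poly ` {xs. set xs \<subseteq> Orb \<and> length xs = length bs}"
    proof
      fix q assume "q \<in> S"
      then obtain d where d: "d \<in> D" "q = map_poly d u" by (auto simp: S_def)
      have "set (map d bs) \<subseteq> Orb" unfolding Orb_def using DG[OF d(1)] bs by auto
      then show "q \<in> Poly ` {xs. set xs \<subseteq> Orb \<and> length xs = length bs}"
        using d map_Poly by auto
    qed
    ultimately show "finite S" by (meson finite_imageI finite_subset)
    have "id \<in> D" using subgroup.one_closed[OF D] by simp
    moreover have "map_poly id u = u" by simp
    ultimately show "u \<in> S" unfolding S_def by force
    show "ring_map (map_poly g)" using g_ring by (rule ring_map_map_poly)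
    show "map_poly g q = q" if q: "\<And>r. r \<in> map_poly ` D \<Longrightarrow> r q = q" for q
    proof (rule poly_eqI)
      fix n
      have "d (Polynomial.coeff q n) = Polynomial.coeff q n" if "d \<in> D" for d
        using q[of "map_poly d"] that coeff_map_poly_ring_map[OF D_ring[OF that], of q n] by simp
      then show "Polynomial.coeff (map_poly g q) n = Polynomial.coeff q n"
        unfolding coeff_map_poly_ring_map[OF g_ring] by (rule fix_g)
    qed
    fix r assume "r \<in> map_poly ` D"
    then obtain d where d: "d \<in> D" "r = map_poly d" by blast
    have inj: "inj d" using DG[OF d(1)] by (simp add: mem_Gal_iff bij_is_inj)
    show "ring_map r \<and> inj_on r S \<and> r ` S = S"
    proof (intro conjI)
      show "ring_map r" unfolding d(2) by (rule ring_map_map_poly[OF D_ring[OF d(1)]])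
      have "inj r"
        unfolding d(2) inj_def poly_eq_iff coeff_map_poly_ring_map[OF D_ring[OF d(1)]] inj_eq[OF inj] by simp
      then show "inj_on r S" by (rule inj_on_subset) simp
      have comp: "e \<circ> f \<in> D" if "e \<in> D" "f \<in> D" for e f
        using subgroup.m_closed[OF D that] by simp
      have d': "m_inv (Gal i) d \<in> D" using D d(1) by (rule subgroup.m_inv_closed)
      show "r ` S = S"
      proof (intro subset_antisym subsetI)
        fix q assume "q \<in> r ` S"
        then obtain e where e: "e \<in> D" "q = map_poly (d \<circ> e) u"
          unfolding S_def d(2) using map_comp[OF d(1)] by auto
        then show "q \<in> S" using comp[OF d(1) e(1)] unfolding S_def by blast
      next
        fix q assume "q \<in> S"
        then obtain e where e: "e \<in> D" "q = map_poly e u" by (auto simp: S_def)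
        have "d \<circ> (m_inv (Gal i) d \<circ> e) = e"
          by (simp add: fun_eq_iff Gal_inv_apply(2)[OF DG[OF d(1)]])
        then have "q = r (map_poly (m_inv (Gal i) d \<circ> e) u)"
          unfolding d(2) e(2) map_comp[OF d(1) comp[OF d' e(1)]] by simp
        then show "q \<in> r ` S" using comp[OF d' e(1)] unfolding S_def by blast
      qed
    qed
  qed
  then obtain d where d: "d \<in> D" "map_poly g u = map_poly d u" by (auto simp: S_def)
  have "d b = g b" if b: "b \<in> B" for b
  proof -
    have "b \<in> set bs" using b bs by simp
    then obtain j where j: "j < length bs" "b = bs ! j" unfolding in_set_conv_nth by blast
    have "d (bs ! j) = Polynomial.coeff (map_poly d u) j"
      by (rule coeff[OF D_ring[OF d(1)] j(1), symmetric])
    also have "\<dots> = Polynomial.coeff (map_poly g u) j" by (simp only: d(2))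
    also have "\<dots> = g (bs ! j)" by (rule coeff[OF g_ring j(1)])
    finally show ?thesis by (simp only: j(2))
  qed
  then show False using no d(1) by blast
qed

context galois_subgroup
begin

lemma K_m_inv: "g \<in> K \<Longrightarrow> m_inv (Gal i) g \<in> K"
  by (rule subgroup.m_inv_closed[OF K])

lemma M_eq_fixed_field_derived:
  "M = {y. \<forall>d \<in> derived (Gal i) K. d y = y}"
proof (intro subset_antisym subsetI)
  interpret group "Gal i" by (rule group_Gal)
  fix y assume y: "y \<in> M"
  have "d y = y" if "d \<in> generate (Gal i) (derived_set (Gal i) K)" for d
    using that
  proof induction
    case one
    then show ?case by simp
  next
    case (incl d)
    then obtain g h where gh: "g \<in> K" "h \<in> K" "d = g \<circ> h \<circ> m_inv (Gal i) g \<circ> m_inv (Gal i) h" by auto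
    have "g (h (m_inv (Gal i) g (m_inv (Gal i) h y))) = g (h (m_inv (Gal i) h (m_inv (Gal i) g y)))"
      using M_commute[OF y K_m_inv[OF gh(1)] K_m_inv[OF gh(2)]] by simp
    then show ?case
      by (simp add: gh(3) Gal_inv_apply(2)[OF K_Gal[OF gh(1)]] Gal_inv_apply(2)[OF K_Gal[OF gh(2)]])
  next
    case (inv d)
    then obtain g h where gh: "g \<in> K" "h \<in> K" "d = g \<circ> h \<circ> m_inv (Gal i) g \<circ> m_inv (Gal i) h" by auto
    have "g (h (m_inv (Gal i) g (m_inv (Gal i) h y))) = g (h (m_inv (Gal i) h (m_inv (Gal i) g y)))"
      using M_commute[OF y K_m_inv[OF gh(1)] K_m_inv[OF gh(2)]] by simp
    then have "d y = y"
      by (simp add: gh(3) Gal_inv_apply(2)[OF K_Gal[OF gh(1)]] Gal_inv_apply(2)[OF K_Gal[OF gh(2)]])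
    moreover have "d \<in> K" using gh K_comp K_m_inv by simp
    ultimately show ?case using Gal_inv_apply(1)[OF K_Gal[of d], of y] by simp
  next
    case (eng d e)
    then show ?case by simp
  qed
  then show "y \<in> {y. \<forall>d \<in> derived (Gal i) K. d y = y}" by (simp add: derived_def)
next
  fix y assume y: "y \<in> {y. \<forall>d \<in> derived (Gal i) K. d y = y}"
  show "y \<in> M"
    unfolding M_def
  proof (intro CollectI ballI)
    fix g h assume gh: "g \<in> K" "h \<in> K"
    define g' where "g' = m_inv (Gal i) g"
    define h' where "h' = m_inv (Gal i) h"
    have g': "g' \<in> K" "m_inv (Gal i) g' = g" "g (g' z) = z" for z
      unfolding g'_def using gh(1) by (auto intro!: K_m_inv Gal_inv_apply(2) group.inv_inv[OF group_Gal] K_Gal)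
    have h': "h' \<in> K" "m_inv (Gal i) h' = h" "h (h' z) = z" for z
      unfolding h'_def using gh(2) by (auto intro!: K_m_inv Gal_inv_apply(2) group.inv_inv[OF group_Gal] K_Gal)
    have "g' \<otimes>\<^bsub>Gal i\<^esub> h' \<otimes>\<^bsub>Gal i\<^esub> m_inv (Gal i) g' \<otimes>\<^bsub>Gal i\<^esub> m_inv (Gal i) h' \<in> derived (Gal i) K"
      unfolding derived_def using g'(1) h'(1) by (intro generate.incl) blast
    then have "g' \<circ> h' \<circ> g \<circ> h \<in> derived (Gal i) K" by (simp add: g'(2) h'(2))
    then have "(g' \<circ> h' \<circ> g \<circ> h) y = y" using y by blast
    then have "h (g (g' (h' (g (h y))))) = h (g y)" by simp
    then show "g (h y) = h (g y)" by (simp only: g'(3) h'(3))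
  qed
qed

text \<open>The condition on \<open>c\<close> says that it lies in the closure of the commutator subgroup; this
  closure and the commutator subgroup have the same fixed field \<open>M\<close>.\<close>
lemma closure_derived_prime_saturated:
  assumes l: "Factorial_Ring.prime l" and c: "c \<in> K"
    and cl: "\<And>B. finite B \<Longrightarrow> \<exists>d\<in>derived (Gal i) K. \<forall>b\<in>B. d b = (c ^^ l) b"
    and B: "finite B"
  shows "\<exists>d\<in>derived (Gal i) K. \<forall>b\<in>B. d b = c b"
proof (rule ccontr)
  assume no: "\<not> ?thesis"
  have D: "subgroup (derived (Gal i) K) (Gal i)"
    by (rule group.derived_is_subgroup[OF group_Gal]) (use K_Gal in blast)
  obtain y where y: "\<forall>d\<in>derived (Gal i) K. d y = y" "c y \<noteq> y"
    using fixed_element_moved_if_no_agreement[OF i alg D K_Gal[OF c] B no] by blast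
  have "(c ^^ l) z = z" if z: "z \<in> M" for z
  proof -
    obtain d where d: "d \<in> derived (Gal i) K" "\<forall>b\<in>{z}. d b = (c ^^ l) b" using cl[of "{z}"] by auto
    have "d z = z" using z d(1) unfolding M_eq_fixed_field_derived by blast
    then show ?thesis using d(2) by simp
  qed
  moreover have "y \<in> M" using y(1) unfolding M_eq_fixed_field_derived by blast
  ultimately have "c y = y" by (rule trivial_on_M[OF l c])
  then show False using y(2) by blast
qed

end

lemma torsion_free_if_no_prime_torsion:
  assumes "group A"
    and prime: "\<And>x l::nat. x \<in> carrier A \<Longrightarrow> Factorial_Ring.prime l \<Longrightarrow> x [^]\<^bsub>A\<^esub> l = \<one>\<^bsub>A\<^esub> \<Longrightarrow> x = \<one>\<^bsub>A\<^esub>"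
  shows "torsion_free A"
proof -
  interpret group A by fact
  have "x = \<one>\<^bsub>A\<^esub>" if "x \<in> carrier A" "n > 0" "x [^]\<^bsub>A\<^esub> n = \<one>\<^bsub>A\<^esub>" for x and n :: nat
    using that
  proof (induction n arbitrary: x rule: less_induct)
    case (less n)
    show ?case
    proof (cases "n = 1")
      case True
      then show ?thesis using less.prems by simp
    next
      case False
      then obtain l where l: "Factorial_Ring.prime l" "l dvd n" using prime_factor_nat by blast
      then obtain k where k: "n = k * l" by (metis dvdE mult.commute)
      have "(x [^]\<^bsub>A\<^esub> k) [^]\<^bsub>A\<^esub> l = \<one>\<^bsub>A\<^esub>" using less.prems k by (simp add: nat_pow_pow)
      then have "x [^]\<^bsub>A\<^esub> k = \<one>\<^bsub>A\<^esub>" using prime l(1) less.prems(1) by simp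
      moreover have "k < n" "k > 0" using k less.prems(2) prime_gt_1_nat[OF l(1)] by auto
      ultimately show ?thesis using less.IH less.prems(1) by blast
    qed
  qed
  then show ?thesis unfolding torsion_free_def by blast
qed

theorem theorem2p1:
  fixes i :: "'f::field \<Rightarrow> 'k::field"
  assumes "separable_closure i"
    and "contains_all_roots_of_unity TYPE('f)"
  shows "totally_torsion_free (Gal i) (krull_topology i)"
proof -
  have i: "field_embedding i" and alg: "\<And>x. separable_over i x" and sc: "separably_closed TYPE('k)"
    using assms(1) by (auto simp: separable_closure_def)
  interpret Gal: group "Gal i" by (rule group_Gal)
  have "torsion_free (topological_abelianization ((Gal i)\<lparr>carrier := K\<rparr>) (subtopology (krull_topology i) K))"
    if K: "subgroup K (Gal i)" for K
  proof -
    interpret galois_subgroup i K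
      by (rule galois_subgroup.intro[OF i alg sc assms(2) K])
    define G where "G = (Gal i)\<lparr>carrier := K\<rparr>"
    define D where "D = derived (Gal i) K"
    define N where "N = {g \<in> K. \<forall>B. finite B \<longrightarrow> (\<exists>d\<in>D. \<forall>b\<in>B. d b = g b)}"
    have KG: "K \<subseteq> carrier (Gal i)" by (rule subgroup.subset[OF K])
    have "group G" unfolding G_def by (rule Gal.subgroup_imp_group[OF K])
    then interpret G: group G .
    have G_simps: "carrier G = K" "g \<otimes>\<^bsub>G\<^esub> h = g \<circ> h" "\<one>\<^bsub>G\<^esub> = id" for g h
      by (simp_all add: G_def Gal_def)
    have G_inv: "m_inv G g = m_inv (Gal i) g" if "g \<in> K" for g
      unfolding G_def by (rule Gal.m_inv_consistent[OF K that])
    have G_pow: "g [^]\<^bsub>G\<^esub> n = g ^^ n" for g and n :: nat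
      unfolding G_def Gal.nat_pow_consistent[symmetric] by (rule Gal_pow)
    have D_eq: "derived G K = D"
      unfolding G_def D_def by (rule Gal.derived_consistent[OF order_refl K])
    have DK: "D \<subseteq> K" unfolding D_def by (rule Gal.derived_incl[OF order_refl K])
    have D_normal: "D \<lhd> G"
      unfolding D_def G_def by (rule Gal.derived_subgroup_is_normal[OF K])
    have closure_eq: "subtopology (krull_topology i) K closure_of derived G (carrier G) = N"
      unfolding G_simps D_eq N_def by (rule closure_of_krull[OF i alg DK KG])
    have "N \<lhd> G"
      unfolding G.normal_inv_iff
    proof (intro conjI ballI)
      have D_comp: "d \<circ> e \<in> D" if "d \<in> D" "e \<in> D" for d e
        using subgroup.m_closed[OF normal_imp_subgroup[OF D_normal] that] by (simp add: G_simps)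
      show "subgroup N G"
      proof (rule G.subgroupI)
        show "N \<subseteq> carrier G" by (auto simp: N_def G_simps)
        have "id \<in> D" using subgroup.one_closed[OF normal_imp_subgroup[OF D_normal]] by (simp add: G_simps)
        then have "id \<in> N" unfolding N_def using K_id by blast
        then show "N \<noteq> {}" by blast
      next
        fix a assume a: "a \<in> N"
        then have aK: "a \<in> K" by (simp add: N_def)
        have "\<exists>d\<in>D. \<forall>b\<in>B. d b = m_inv (Gal i) a b" if "finite B" for B
        proof -
          have "finite (m_inv (Gal i) a ` B)" using that by simp
          then obtain d where d: "d \<in> D" "\<forall>b\<in>m_inv (Gal i) a ` B. d b = a b"
            using a unfolding N_def by blast
          have dK: "d \<in> K" using d(1) DK by blast
          have "m_inv (Gal i) d \<in> D"
            using subgroup.m_inv_closed[OF normal_imp_subgroup[OF D_normal] d(1)] G_inv[OF dK] by simp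
          moreover have "m_inv (Gal i) d b = m_inv (Gal i) a b" if "b \<in> B" for b
          proof -
            have "d (m_inv (Gal i) a b) = b" using d(2) that Gal_inv_apply(2)[OF K_Gal[OF aK]] by simp
            then show ?thesis using Gal_inv_apply(1)[OF K_Gal[OF dK]] by metis
          qed
          ultimately show ?thesis by blast
        qed
        then show "m_inv G a \<in> N" unfolding G_inv[OF aK] N_def using K_m_inv[OF aK] by blast
      next
        fix a b assume ab: "a \<in> N" "b \<in> N"
        then have abK: "a \<in> K" "b \<in> K" by (simp_all add: N_def)
        have "\<exists>d\<in>D. \<forall>z\<in>B. d z = (a \<circ> b) z" if B: "finite B" for B
        proof -
          obtain e where e: "e \<in> D" "\<forall>z\<in>B. e z = b z" using ab(2) B unfolding N_def by blast
          obtain d where d: "d \<in> D" "\<forall>z\<in>b ` B. d z = a z"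
            using ab(1) finite_imageI[OF B, of b] unfolding N_def by blast
          show ?thesis using D_comp[OF d(1) e(1)] d(2) e(2) by (intro bexI[of _ "d \<circ> e"]) auto
        qed
        then show "a \<otimes>\<^bsub>G\<^esub> b \<in> N" unfolding G_simps N_def using K_comp[OF abK] by blast
      qed
    next
      fix g h assume "g \<in> carrier G" and h: "h \<in> N"
      then have gK: "g \<in> K" and hK: "h \<in> K" by (simp_all add: G_simps N_def)
      have "\<exists>d\<in>D. \<forall>b\<in>B. d b = (g \<circ> h \<circ> m_inv (Gal i) g) b" if B: "finite B" for B
      proof -
        obtain d where d: "d \<in> D" "\<forall>b\<in>m_inv (Gal i) g ` B. d b = h b"
          using h finite_imageI[OF B, of "m_inv (Gal i) g"] unfolding N_def by blast
        have "g \<circ> d \<circ> m_inv (Gal i) g \<in> D"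
          using D_normal d(1) gK unfolding G.normal_inv_iff by (simp add: G_simps G_inv)
        then show ?thesis using d(2) by (intro bexI[of _ "g \<circ> d \<circ> m_inv (Gal i) g"]) auto
      qed
      moreover have "g \<circ> h \<circ> m_inv (Gal i) g \<in> K" by (intro K_comp gK hK K_m_inv)
      ultimately show "g \<otimes>\<^bsub>G\<^esub> h \<otimes>\<^bsub>G\<^esub> m_inv G g \<in> N"
        unfolding G_simps G_inv[OF gK] N_def by blast
    qed
    then interpret N: normal N G .
    have "torsion_free (G Mod N)"
    proof (rule torsion_free_if_no_prime_torsion[OF N.factorgroup_is_group])
      fix x and l :: nat
      assume "x \<in> carrier (G Mod N)" and l: "Factorial_Ring.prime l" and xl: "x [^]\<^bsub>G Mod N\<^esub> l = \<one>\<^bsub>G Mod N\<^esub>"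
      then obtain c where c: "c \<in> K" "x = N #>\<^bsub>G\<^esub> c" by (auto simp: carrier_FactGroup G_simps)
      have cl: "c ^^ l \<in> K" using c(1) by (rule K_funpow)
      have "N #>\<^bsub>G\<^esub> (c ^^ l) = N" using xl c N.FactGroup_pow[of c l] by (simp add: G_simps G_pow)
      then have "c ^^ l \<in> N" using G.coset_join1 cl N.subgroup_axioms by (metis G_simps(1))
      then have "c \<in> N"
        using closure_derived_prime_saturated[OF l c(1)] c(1) by (auto simp: N_def D_def)
      then show "x = \<one>\<^bsub>G Mod N\<^esub>"
        using c G.coset_join2[of c N] N.subgroup_axioms by (simp add: G_simps)
    qed
    then show ?thesis unfolding topological_abelianization_def G_def[symmetric] closure_eq .
  qed
  then show ?thesis
    unfolding totally_torsion_free_def using hausdorff_topological_group_Gal[OF i alg] by blast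
qed

end
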